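(* Let $S = R\cup B$ be a finite set of points in the plane in general position (no three collinear), colored red ($R$) and blue ($B$), such that $R$ and $B$ are not linearly separable. Then $S$ has a balanced convex $4$-hole if and only if one of the following holds: (1) $CH(B)\subset CH(R)$, $|R|=3$, $|B|\ge 2$, and there is an edge $\overline{uv}$ of $CH(B)$ ($u,v\in B$) such that one of the open half-planes bounded by the line through $u,v$ contains exactly two red points and no blue point; (2) $CH(R)\subset CH(B)$, $|B|=3$, $|R|\ge 2$, and there is an edge $\overline{uv}$ of $CH(R)$ ($u,v\in R$) such that one of the open half-planes bounded by the line through $u,v$ contains exactly two blue points and no red point; (3) $CH(B)\subset CH(R)$, $|R|\ge 4$, $|B|\ge 2$; (4) $CH(R)\subset CH(B)$, $|B|\ge 4$, $|R|\ge 2$; (5) the boundaries of $CH(B)$ and $CH(R)$ intersect each other.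
   Context: A $4$-hole of $S$ is a simple quadrilateral with vertices in $S$ and no point of $S$ in its interior; it is convex if the quadrilateral is convex, and balanced if it has exactly two red and two blue vertices. $CH(X)$ denotes the convex hull of $X$. $R$ and $B$ are linearly separable if some line has all of $R$ strictly on one side and all of $B$ strictly on the other. *)

theory Defs
  imports "HOL-Analysis.Analysis"
begin

type_synonym point = "real \<times> real"

text \<open>Orientation determinant: positive iff p is strictly left of the directed line u v.\<close>
definition orient :: "point \<Rightarrow> point \<Rightarrow> point \<Rightarrow> real" where
  "orient u v p = (fst v - fst u) * (snd p - snd u) - (snd v - snd u) * (fst p - fst u)"

definition general_position :: "point set \<Rightarrow> bool" where
  "general_position S \<longleftrightarrow>
     (\<forall>a\<in>S. \<forall>b\<in>S. \<forall>c\<in>S. a \<noteq> b \<and> a \<noteq> c \<and> b \<noteq> c \<longrightarrow> \<not> collinear {a, b, c})"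

definition linearly_separable :: "point set \<Rightarrow> point set \<Rightarrow> bool" where
  "linearly_separable R B \<longleftrightarrow>
     (\<exists>a c. a \<noteq> 0 \<and> (\<forall>r\<in>R. inner a r < c) \<and> (\<forall>b\<in>B. inner a b > c))"

definition convex_4hole :: "point set \<Rightarrow> point set \<Rightarrow> bool" where
  "convex_4hole S Q \<longleftrightarrow>
     Q \<subseteq> S \<and> card Q = 4 \<and>
     (\<forall>q\<in>Q. q \<notin> convex hull (Q - {q})) \<and>
     interior (convex hull Q) \<inter> S = {}"

definition balanced_convex_4hole :: "point set \<Rightarrow> point set \<Rightarrow> point set \<Rightarrow> bool" where
  "balanced_convex_4hole R B Q \<longleftrightarrow>
     convex_4hole (R \<union> B) Q \<and> card (Q \<inter> R) = 2 \<and> card (Q \<inter> B) = 2"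

definition edge_cond :: "point set \<Rightarrow> point set \<Rightarrow> bool" where
  "edge_cond X Y \<longleftrightarrow>
     (\<exists>u\<in>X. \<exists>v\<in>X. u \<noteq> v \<and> closed_segment u v face_of convex hull X \<and>
        ((card {y\<in>Y. orient u v y > 0} = 2 \<and> (\<forall>x\<in>X. \<not> orient u v x > 0)) \<or>
         (card {y\<in>Y. orient u v y < 0} = 2 \<and> (\<forall>x\<in>X. \<not> orient u v x < 0))))"

end

theory Submission
  imports Defs
begin

text \<open>If a red segment crosses a blue segment, then a crossing pair whose four end points span a hull
  with as few points as possible is a balanced convex hole: a point of, say, colour red in the hull can
  replace one of the two red end points. Intersecting hull boundaries produce such a crossing.

  If the blue hull lies inside the red one and there is no crossing, then all blue points lie in one red
  triangle without further red points. An edge of the blue hull with exactly two corners of the triangle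
  beyond it gives a hole, so each blue edge may be assumed to see exactly one corner. A fourth red point,
  chosen so that its hull with the triangle contains no further red point, then yields a hole. If it is in
  convex position with the triangle, take a blue edge that sees a suitable corner; it also sees the fourth
  point. Otherwise the fourth point lies behind a corner; take a blue edge that sees this corner and, if the
  line through the two red points separates its end points, rotate around one of these.

  Conversely, let there be exactly three red points around the blue ones. If the tangents to the blue hull
  from the two red vertices of a hole touched at the same blue point, this point would lie inside the hole.
  So they touch at distinct points, and a blue edge between the two sees both red vertices.\<close>

section \<open>Orientations and convex hulls\<close>

lemma orient_rotate: "orient a b c = orient b c a"
  by (simp add: orient_def algebra_simps)

lemma orient_swap: "orient b a c = - orient a b c"
  by (simp add: orient_def algebra_simps)

lemma orient_degenerate [simp]:
  "orient a a b = 0" "orient a b a = 0" "orient a b b = 0"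
  by (simp_all add: orient_def algebra_simps)

lemma orient_convex_comb:
  assumes "l + m + n = 1"
  shows "orient p q (l *\<^sub>R a + m *\<^sub>R b + n *\<^sub>R c) = l * orient p q a + m * orient p q b + n * orient p q c"
proof -
  have l: "l = 1 - m - n" using assms by simp
  show ?thesis unfolding l by (simp add: orient_def algebra_simps)
qed

lemma orient_as_inner:
  "orient p q x = inner (snd p - snd q, fst q - fst p) x - inner (snd p - snd q, fst q - fst p) p"
  by (simp add: orient_def inner_prod_def algebra_simps)

text \<open>Half-planes are convex. The factor \<open>s\<close> selects the side of the line; with a
  triangle's determinant or a sign in its place, later proofs avoid case splits on
  orientation.\<close>

lemma orient_nonneg_on_hull:
  assumes "\<And>x. x \<in> Q \<Longrightarrow> s * orient p q x \<ge> 0" and "y \<in> convex hull Q"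
  shows "s * orient p q y \<ge> 0"
proof -
  let ?a = "s *\<^sub>R (snd p - snd q, fst q - fst p)"
  have eq: "s * orient p q x \<ge> 0 \<longleftrightarrow> inner ?a x \<ge> inner ?a p" for x
    by (simp add: orient_as_inner inner_prod_def algebra_simps)
  have "convex hull Q \<subseteq> {x. inner ?a x \<ge> inner ?a p}"
    using assms(1) eq by (intro hull_minimal convex_halfspace_ge) auto
  then show ?thesis using assms(2) eq by auto
qed

lemma orient_pos_on_interior_hull:
  assumes "\<And>x. x \<in> Q \<Longrightarrow> s * orient p q x \<ge> 0" and "p \<noteq> q" "s \<noteq> 0"
    and "y \<in> interior (convex hull Q)"
  shows "s * orient p q y > 0"
proof -
  let ?a = "s *\<^sub>R (snd p - snd q, fst q - fst p)"
  have eq: "s * orient p q x = inner ?a x - inner ?a p" for x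
    by (simp add: orient_as_inner inner_prod_def algebra_simps)
  have a0: "?a \<noteq> 0" using assms(2,3) by (auto simp: prod_eq_iff)
  have "convex hull Q \<subseteq> {x. inner ?a x \<ge> inner ?a p}"
    using assms(1) unfolding eq by (intro hull_minimal convex_halfspace_ge) auto
  then have "interior (convex hull Q) \<subseteq> {x. inner ?a x > inner ?a p}"
    using interior_mono interior_halfspace_ge[OF a0] by metis
  then have "inner ?a y > inner ?a p" using assms(4) by blast
  then show ?thesis unfolding eq by linarith
qed

lemma orient_neq_0:
  assumes "general_position S" "a \<in> S" "b \<in> S" "c \<in> S" "a \<noteq> b" "a \<noteq> c" "b \<noteq> c"
  shows "orient a b c \<noteq> 0"
proof
  assume 0: "orient a b c = 0"
  obtain t where t: "t * (fst b - fst a) = fst c - fst a" "t * (snd b - snd a) = snd c - snd a"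
  proof (cases "fst a = fst b")
    case True
    then have "snd a \<noteq> snd b" using assms(5) by (auto simp: prod_eq_iff)
    moreover then have "fst c = fst a" using 0 True by (auto simp: orient_def)
    ultimately show thesis using True that[of "(snd c - snd a) / (snd b - snd a)"] by simp
  next
    case False
    then have "snd c - snd a = (fst c - fst a) / (fst b - fst a) * (snd b - snd a)"
      using 0 by (simp add: orient_def field_simps)
    then show thesis using False that[of "(fst c - fst a) / (fst b - fst a)"] by simp
  qed
  then have "c = (1 - t) *\<^sub>R a + (1 - (1 - t)) *\<^sub>R b"
    by (auto simp: prod_eq_iff algebra_simps)
  then have "collinear {a, c, b}" unfolding collinear_3_expand by blast
  then have "collinear {a, b, c}" by (simp add: insert_commute)
  then show False using assms unfolding general_position_def by blast
qed

lemma orient_collinear: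
  assumes "z \<in> closed_segment a b"
  shows "orient a b z = 0"
proof -
  obtain u where z: "z = (1 - u) *\<^sub>R a + u *\<^sub>R b" using assms by (auto simp: closed_segment_def)
  show ?thesis unfolding z by (simp add: orient_def algebra_simps)
qed

section \<open>Barycentric coordinates and triangles\<close>

text \<open>Cramer's rule: each coordinate is the determinant of the triangle with one corner
  replaced by \<open>p\<close>, divided by that of the triangle.\<close>

lemma orient_barycentric:
  assumes "orient a b c \<noteq> 0"
  shows "p = (orient b c p / orient a b c) *\<^sub>R a + (orient c a p / orient a b c) *\<^sub>R b
              + (orient a b p / orient a b c) *\<^sub>R c"
    and "orient b c p / orient a b c + orient c a p / orient a b c + orient a b p / orient a b c = 1"
proof -
  define D where "D = orient a b c"
  have D: "D \<noteq> 0" using assms D_def by simp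
  have 1: "D * fst p = orient b c p * fst a + orient c a p * fst b + orient a b p * fst c"
    and 2: "D * snd p = orient b c p * snd a + orient c a p * snd b + orient a b p * snd c"
    and 3: "orient b c p + orient c a p + orient a b p = D"
    unfolding D_def orient_def by (simp_all add: algebra_simps)
  have "fst p = (orient b c p * fst a + orient c a p * fst b + orient a b p * fst c) / D"
    "snd p = (orient b c p * snd a + orient c a p * snd b + orient a b p * snd c) / D"
    using 1 2 D by (metis nonzero_mult_div_cancel_left)+
  then show "p = (orient b c p / orient a b c) *\<^sub>R a + (orient c a p / orient a b c) *\<^sub>R b
              + (orient a b p / orient a b c) *\<^sub>R c"
    unfolding D_def[symmetric] by (simp add: prod_eq_iff add_divide_distrib)
  show "orient b c p / orient a b c + orient c a p / orient a b c + orient a b p / orient a b c = 1"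
    using D 3 unfolding D_def[symmetric] by (metis add_divide_distrib divide_self)
qed

lemma in_triangle_iff:
  assumes "s * orient a b c > 0"
  shows "p \<in> convex hull {a, b, c} \<longleftrightarrow>
    s * orient a b p \<ge> 0 \<and> s * orient b c p \<ge> 0 \<and> s * orient c a p \<ge> 0"
proof
  assume p: "p \<in> convex hull {a, b, c}"
  have r: "orient b c a = orient a b c" "orient c a b = orient a b c"
    by (metis orient_rotate)+
  show "s * orient a b p \<ge> 0 \<and> s * orient b c p \<ge> 0 \<and> s * orient c a p \<ge> 0"
    using assms r by (intro conjI orient_nonneg_on_hull[OF _ p]) auto
next
  assume n: "s * orient a b p \<ge> 0 \<and> s * orient b c p \<ge> 0 \<and> s * orient c a p \<ge> 0"
  have D: "orient a b c \<noteq> 0" and s: "s \<noteq> 0" using assms by auto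
  have "x / orient a b c \<ge> 0" if "s * x \<ge> 0" for x
  proof -
    have "x / orient a b c = (s * x) / (s * orient a b c)" using s by simp
    then show ?thesis using that assms by (metis divide_nonneg_pos)
  qed
  then show "p \<in> convex hull {a, b, c}"
    unfolding convex_hull_3 using n orient_barycentric[OF D, of p] by blast
qed

text \<open>The strict inequalities cut out an open set, and the three determinants add up to that
  of the triangle, which fixes its sign.\<close>

lemma in_interior_triangle:
  assumes "s * orient a b p > 0" "s * orient b c p > 0" "s * orient c a p > 0"
  shows "p \<in> interior (convex hull {a, b, c})"
proof -
  let ?U = "{x. s * orient a b x > 0} \<inter> {x. s * orient b c x > 0} \<inter> {x. s * orient c a x > 0}"
  have cont: "continuous_on UNIV (\<lambda>x. s * orient u v x)" for u v
    unfolding orient_def by (intro continuous_intros)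
  have "open {x. s * orient u v x > 0}" for u v
    using open_Collect_less[OF continuous_on_const cont] .
  then have op: "open ?U" by blast
  have "orient b c p + orient c a p + orient a b p = orient a b c"
    by (simp add: orient_def algebra_simps)
  then have "s * orient a b c > 0" using assms
    by (metis distrib_left add_pos_pos)
  then have "?U \<subseteq> convex hull {a, b, c}" by (auto simp: in_triangle_iff)
  then show ?thesis using assms op by (auto intro: interiorI)
qed

text \<open>The ratio of the two coordinates in the orthogonal frame given by a is a monotone function of
  the angle.\<close>
lemma angular_extreme:
  fixes s :: real
  assumes "finite X" "X \<noteq> {}" "\<And>x. x \<in> X \<Longrightarrow> inner a (x - p) > 0"
  obtains v where "v \<in> X" "\<And>x. x \<in> X \<Longrightarrow> s * orient p v x \<le> 0"
proof -
  define cr where "cr x = fst a * (snd x - snd p) - snd a * (fst x - fst p)" for x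
  define ip where "ip x = inner a (x - p)" for x
  have ip: "ip x > 0" if "x \<in> X" for x using assms(3) that ip_def by auto
  obtain v where v: "v \<in> X" "\<And>x. x \<in> X \<Longrightarrow> s * cr x / ip x \<le> s * cr v / ip v"
  proof -
    let ?f = "\<lambda>x. s * cr x / ip x"
    have "Max (?f ` X) \<in> ?f ` X" using assms by (intro Max_in) auto
    then obtain v where "v \<in> X" "Max (?f ` X) = ?f v" by auto
    moreover have "?f x \<le> Max (?f ` X)" if "x \<in> X" for x using that assms(1) by simp
    ultimately show thesis using that by simp
  qed
  have "s * orient p v x \<le> 0" if x: "x \<in> X" for x
  proof -
    have "s * cr x * ip v \<le> s * cr v * ip x"
      using v(2)[OF x] ip[OF x] ip[OF v(1)] by (simp add: pos_divide_le_eq pos_le_divide_eq)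
    \<comment> \<open>\<open>ip\<close> and \<open>cr\<close> are, up to scaling, coordinates along
      \<open>a\<close> and along \<open>a\<close> turned by a right angle; this is the determinant
      of \<open>v - p\<close> and \<open>x - p\<close> in that frame.\<close>
    moreover have "inner a a * (s * orient p v x) = s * cr x * ip v - s * cr v * ip x"
      unfolding cr_def ip_def orient_def inner_prod_def by (simp add: algebra_simps)
    moreover have "inner a a > 0" using ip[OF x] unfolding ip_def by auto
    ultimately show ?thesis by (metis diff_le_0_iff_le mult_le_0_iff not_less)
  qed
  then show thesis using that v(1) by blast
qed

lemma angular_extreme_orient:
  fixes s t :: real
  assumes "finite X" "X \<noteq> {}" "\<And>x. x \<in> X \<Longrightarrow> t * orient q p x > 0"
  obtains v where "v \<in> X" "\<And>x. x \<in> X \<Longrightarrow> s * orient p v x \<le> 0"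
proof (rule angular_extreme[OF assms(1,2)])
  fix x assume "x \<in> X"
  have "t * orient q p x = inner (t *\<^sub>R (snd q - snd p, fst p - fst q)) (x - p)"
    by (simp add: orient_def inner_prod_def algebra_simps)
  then show "inner (t *\<^sub>R (snd q - snd p, fst p - fst q)) (x - p) > 0"
    using assms(3)[OF \<open>x \<in> X\<close>] by simp
qed (use that in blast)

text \<open>Turn a line about \<open>c\<close> until it touches the set at \<open>u\<close>, then
  about \<open>u\<close> to the next point \<open>v\<close>; the line \<open>u v\<close> supports
  the set with \<open>c\<close> on the other side.\<close>

lemma visible_edge:
  assumes "finite B" "general_position (insert c B)" "card B \<ge> 2" "c \<notin> convex hull B"
  obtains u v where "u \<in> B" "v \<in> B" "u \<noteq> v" "orient u v c > 0" "\<And>b. b \<in> B \<Longrightarrow> orient u v b \<le> 0"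
proof -
  have cl: "closed (convex hull B)"
    using assms(1) by (simp add: compact_imp_closed finite_imp_compact_convex_hull)
  obtain a d where ad: "inner a c < d" "\<forall>x\<in>convex hull B. inner a x > d"
    using separating_hyperplane_closed_point[OF convex_convex_hull cl assms(4)] by blast
  have cB: "c \<notin> B" using assms(4) hull_inc by metis
  have "B \<noteq> {}" using assms(3) by auto
  moreover have "inner a (x - c) > 0" if "x \<in> B" for x
    using ad that hull_inc[OF that, of convex] by (fastforce simp: inner_diff_right)
  ultimately obtain u where u: "u \<in> B" "\<And>x. x \<in> B \<Longrightarrow> (-1) * orient c u x \<le> 0"
    using angular_extreme[OF assms(1)] by metis
  have pos: "1 * orient c u x > 0" if "x \<in> B - {u}" for x
    using u(2)[of x] orient_neq_0[OF assms(2), of c u x] that u(1) cB by fastforce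
  have "B - {u} \<noteq> {}"
    using assms(1,3) by (metis card_1_singleton_iff card.empty insert_Diff numeral_le_one_iff semiring_norm(69) u(1) One_nat_def)
  then obtain v where v: "v \<in> B - {u}" "\<And>x. x \<in> B - {u} \<Longrightarrow> 1 * orient u v x \<le> 0"
    using angular_extreme_orient[OF _ _ pos] assms(1) by (metis finite_Diff)
  have "orient u v b \<le> 0" if "b \<in> B" for b using v(2) that by (cases "b = u") auto
  moreover have "orient u v c > 0" using pos[OF v(1)] orient_rotate[of c u v] by simp
  ultimately show thesis using that u(1) v(1) by blast
qed

lemma vertex_notin_interior:
  fixes Q :: "point set"
  assumes "finite Q" "q \<in> Q" "q \<notin> convex hull (Q - {q})"
  shows "q \<notin> interior (convex hull Q)"
proof -
  have "q extreme_point_of (convex hull insert q (Q - {q}))"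
    using assms by (intro extreme_point_of_convex_hull_insert) auto
  then show ?thesis using assms(2) extreme_point_not_in_interior by (simp add: insert_absorb)
qed

text \<open>The extreme point \<open>q\<close> leaves the hull and nothing new enters. This is the
  descent for the induction on crossings and for minimal choices of red points.\<close>

lemma card_hull_exchange_less:
  fixes S Q :: "point set"
  assumes "finite S" "finite Q" "q \<in> Q" "q \<in> S" "q \<notin> convex hull (Q - {q})"
    and "p \<in> convex hull Q" "p \<noteq> q" "Q' \<subseteq> insert p (Q - {q})"
  shows "card (S \<inter> convex hull Q') < card (S \<inter> convex hull Q)"
proof (rule psubset_card_mono)
  have "Q' \<subseteq> convex hull Q" using assms(6,8) hull_subset[of Q convex] by blast
  then have sub: "convex hull Q' \<subseteq> convex hull Q" by (simp add: hull_minimal)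
  have ext: "q extreme_point_of (convex hull Q)"
    using extreme_point_of_convex_hull_insert[of "Q - {q}" q] assms(2,3,5) by (simp add: insert_absorb)
  have "q \<notin> convex hull Q'"
  proof
    assume "q \<in> convex hull Q'"
    then have "q extreme_point_of (convex hull Q')"
      using ext sub unfolding extreme_point_of_def by blast
    then have "q \<in> Q'" using extreme_point_of_convex_hull by blast
    then show False using assms(7,8) by auto
  qed
  then show "S \<inter> convex hull Q' \<subset> S \<inter> convex hull Q"
    using sub assms(3,4) hull_inc[of q Q convex] by blast
qed (use assms(1) in simp)

lemma orient_pos_on_hull:
  assumes "\<And>x. x \<in> Q \<Longrightarrow> s * orient p q x > 0" and "y \<in> convex hull Q"
  shows "s * orient p q y > 0"
proof -
  let ?a = "s *\<^sub>R (snd p - snd q, fst q - fst p)"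
  have eq: "s * orient p q x > 0 \<longleftrightarrow> inner ?a x > inner ?a p" for x
    by (simp add: orient_as_inner inner_prod_def algebra_simps)
  have "convex hull Q \<subseteq> {x. inner ?a x > inner ?a p}"
    using assms(1) eq by (intro hull_minimal convex_halfspace_gt) auto
  then show ?thesis using assms(2) eq by auto
qed

section \<open>Crossing segments\<close>

definition crossing :: "point \<Rightarrow> point \<Rightarrow> point \<Rightarrow> point \<Rightarrow> bool" where
  "crossing a a' b b' \<longleftrightarrow> orient a a' b * orient a a' b' < 0 \<and> orient b b' a * orient b b' a' < 0"

lemma crossing_commute: "crossing a a' b b' \<longleftrightarrow> crossing b b' a a'"
  by (auto simp: crossing_def)

lemma crossing_swap: "crossing a a' b b' \<longleftrightarrow> crossing a' a b b'"
  by (auto simp: crossing_def orient_swap[of a' a] mult.commute)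

text \<open>Both differences in \<open>eq\<close> are the determinant of the two direction vectors,
  so the signs on one line fix those on the other up to a mirror image.\<close>

lemma crossing_signs:
  assumes "crossing a a' b b'"
  obtains s :: real where "s \<noteq> 0" "s * orient a a' b > 0" "s * orient a a' b' < 0"
    "s * orient b b' a < 0" "s * orient b b' a' > 0"
proof -
  have eq: "orient a a' b - orient a a' b' = orient b b' a' - orient b b' a"
    by (simp add: orient_def algebra_simps)
  have "orient a a' b * orient a a' b' < 0" "orient b b' a * orient b b' a' < 0"
    using assms crossing_def by auto
  then consider "orient a a' b > 0" "orient a a' b' < 0" "orient b b' a < 0" "orient b b' a' > 0"
    | "orient a a' b < 0" "orient a a' b' > 0" "orient b b' a > 0" "orient b b' a' < 0"
    using eq unfolding mult_less_0_iff by linarith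
  then show thesis by cases (use that[of 1] that[of "-1"] in auto)
qed

lemma crossing_vertex:
  assumes "crossing a a' b b'"
  shows "a \<notin> convex hull {a', b, b'}"
proof
  assume a: "a \<in> convex hull {a', b, b'}"
  obtain s where "s * orient b b' a < 0" "s * orient b b' a' > 0"
    using crossing_signs[OF assms] by metis
  then show False using orient_nonneg_on_hull[OF _ a, of s b b'] by fastforce
qed

text \<open>The hull lies in the wedge at \<open>a'\<close> spanned by the rays to \<open>b\<close>
  and \<open>b'\<close>, so the line from \<open>a'\<close> through \<open>p\<close> still separates
  \<open>b\<close> and \<open>b'\<close>.\<close>

lemma crossing_replace:
  assumes "crossing a a' b b'" "p \<in> convex hull {a, a', b, b'}" "orient b b' p * orient b b' a' < 0"
    and "orient p a' b \<noteq> 0" "orient p a' b' \<noteq> 0"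
  shows "crossing p a' b b'"
proof -
  obtain s where s: "s \<noteq> 0" "s * orient a a' b > 0" "s * orient a a' b' < 0"
    "s * orient b b' a < 0" "s * orient b b' a' > 0" using crossing_signs[OF assms(1)] by metis
  have r: "orient a' b a = orient a a' b" "orient a' b b' = orient b b' a'"
    "orient a' b' a = orient a a' b'" "orient a' b' b = - orient b b' a'"
    "orient p a' b = orient a' b p" "orient p a' b' = orient a' b' p"
    by (simp_all add: orient_def algebra_simps)
  have 1: "s * orient a' b p \<ge> 0"
    using s r by (intro orient_nonneg_on_hull[OF _ assms(2)]) auto
  have 2: "(-s) * orient a' b' p \<ge> 0"
    using s r by (intro orient_nonneg_on_hull[OF _ assms(2)]) auto
  have "s * orient p a' b > 0" "s * orient p a' b' < 0"
    using 1 2 assms(4,5) s(1) r by (auto simp: order_less_le)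
  then have "orient p a' b * orient p a' b' < 0"
    using s(1) by (smt (verit, ccfv_SIG) mult_less_0_iff zero_less_mult_iff)
  then show ?thesis using assms(3) unfolding crossing_def by simp
qed

text \<open>Seen from \<open>p\<close>, the point \<open>q\<close> is between \<open>a\<close> and
  \<open>b\<close>; being outside the triangle, it lies beyond \<open>a b\<close>.\<close>

lemma crossing_through_side:
  assumes "s * orient a b p > 0" "s * orient p a q > 0" "s * orient p b q < 0"
    and "q \<notin> convex hull {p, a, b}"
  shows "crossing p q a b"
proof -
  have "orient p a b = orient a b p" "orient b p q = - orient p b q" "orient p q a = - orient p a q"
     "orient p q b = - orient p b q"
    by (simp_all add: orient_def algebra_simps)
  moreover have "s * orient a b q < 0"
    using in_triangle_iff[of s p a b q] assms calculation by fastforce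
  ultimately show ?thesis using assms unfolding crossing_def
    by (smt (verit, ccfv_SIG) mult_less_0_iff zero_less_mult_iff)
qed

lemma triangle_exit:
  assumes "general_position S" "{a, b, c, p, q} \<subseteq> S" "distinct [a, b, c, p, q]"
    and p: "p \<in> convex hull {a, b, c}" and q: "q \<notin> convex hull {a, b, c}"
  shows "crossing p q a b \<or> crossing p q b c \<or> crossing p q c a"
proof -
  note orient_nonzero = orient_neq_0[OF assms(1)]
  have "orient a b c \<noteq> 0" using assms by (intro orient_nonzero) auto
  then obtain s :: real where s: "s * orient a b c > 0" "s \<noteq> 0"
    by (metis linorder_neqE_linordered_idom mult_neg_neg mult_pos_pos zero_less_one less_irrefl
        neg_less_0_iff_less)
  have "orient a b p \<noteq> 0" "orient b c p \<noteq> 0" "orient c a p \<noteq> 0"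
    "orient p a q \<noteq> 0" "orient p b q \<noteq> 0" "orient p c q \<noteq> 0"
    by (rule orient_nonzero; use assms(2,3) in auto)+
  then have P: "s * orient a b p > 0" "s * orient b c p > 0" "s * orient c a p > 0"
    and Q: "s * orient p a q \<noteq> 0" "s * orient p b q \<noteq> 0" "s * orient p c q \<noteq> 0"
    using p in_triangle_iff[OF s(1)] s(2) by (auto simp: order_less_le)
  have hs: "convex hull {p, a, b} \<subseteq> convex hull {a, b, c}" "convex hull {p, b, c} \<subseteq> convex hull {a, b, c}"
    "convex hull {p, c, a} \<subseteq> convex hull {a, b, c}"
    using p hull_subset[of "{a, b, c}" convex] by (simp_all add: hull_minimal)
  \<comment> \<open>Weighted with the barycentric coordinates of \<open>p\<close>, the corners
    average to \<open>p\<close>, and \<open>orient p p q\<close> vanishes. So the three determinants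
    with \<open>q\<close> cannot all have one sign.\<close>
  have id: "(s * orient b c p) * (s * orient p a q) + (s * orient c a p) * (s * orient p b q)
      + (s * orient a b p) * (s * orient p c q) = 0"
    by (simp add: orient_def algebra_simps)
  \<comment> \<open>Around the triangle some change from plus to minus occurs; it marks the sector
    at \<open>p\<close> that contains \<open>q\<close>.\<close>
  consider "s * orient p a q > 0" "s * orient p b q < 0" | "s * orient p b q > 0" "s * orient p c q < 0"
    | "s * orient p c q > 0" "s * orient p a q < 0"
  proof (rule ccontr)
    assume "\<not> thesis"
    then have "(s * orient p a q > 0 \<and> s * orient p b q > 0 \<and> s * orient p c q > 0) \<or>
        (s * orient p a q < 0 \<and> s * orient p b q < 0 \<and> s * orient p c q < 0)"
      using Q that by (metis linorder_neqE_linordered_idom)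
    then show False using id P by (smt (verit, ccfv_SIG) mult_less_0_iff zero_less_mult_iff)
  qed
  then show ?thesis
  proof cases
    case 1
    then show ?thesis using crossing_through_side[of s a b p q] P q hs by blast
  next
    case 2
    then show ?thesis using crossing_through_side[of s b c p q] P q hs by blast
  next
    case 3
    then show ?thesis using crossing_through_side[of s c a p q] P q hs by blast
  qed
qed

text \<open>\<open>orient u v\<close> vanishes at \<open>u\<close> and \<open>v\<close> and has one
  strict sign at \<open>r\<close> and \<open>r'\<close>, so both would get weight zero and
  \<open>u\<close> would equal \<open>v\<close>.\<close>

lemma same_side_vertex:
  assumes "orient u v r * orient u v r' > 0"
  shows "u \<notin> convex hull {v, r, r'}"
proof
  assume "u \<in> convex hull {v, r, r'}"
  then obtain l m n where lmn: "u = l *\<^sub>R v + m *\<^sub>R r + n *\<^sub>R r'" "l + m + n = 1" "0 \<le> m" "0 \<le> n"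
    unfolding convex_hull_3 by blast
  have "m * orient u v r + n * orient u v r' = 0"
    using orient_convex_comb[OF lmn(2), of u v v r r'] lmn(1) by simp
  then have "m = 0 \<and> n = 0" using lmn(3,4) assms
    by (smt (verit, ccfv_SIG) mult_less_0_iff zero_less_mult_iff)
  then have "u = v" using lmn by simp
  then show False using assms by simp
qed

section \<open>Bicoloured point sets\<close>

locale bicoloured =
  fixes R B :: "point set"
  assumes finite_R: "finite R" and finite_B: "finite B" and disjoint: "R \<inter> B = {}"
    and gen_pos: "general_position (R \<union> B)"
begin

abbreviation has_hole :: bool where
  "has_hole \<equiv> \<exists>Q. balanced_convex_4hole R B Q"

lemma bicoloured_swap: "bicoloured B R"
  using finite_R finite_B disjoint gen_pos by unfold_locales (auto simp: Un_commute)

lemma has_hole_swap: "has_hole \<longleftrightarrow> (\<exists>Q. balanced_convex_4hole B R Q)"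
  unfolding balanced_convex_4hole_def by (auto simp: Un_commute)

lemmas orient_nonzero = orient_neq_0[OF gen_pos]

section \<open>Criteria for a balanced hole\<close>

lemma has_holeI:
  assumes "r \<in> R" "r' \<in> R" "r \<noteq> r'" "u \<in> B" "v \<in> B" "u \<noteq> v"
    and "u \<notin> convex hull {v, r, r'}" "v \<notin> convex hull {u, r, r'}"
    and "r \<notin> convex hull {u, v, r'}" "r' \<notin> convex hull {u, v, r}"
    and "\<And>x. x \<in> R \<union> B \<Longrightarrow> x \<in> interior (convex hull {u, v, r, r'}) \<Longrightarrow> x \<in> {u, v, r, r'}"
  shows has_hole
proof -
  let ?Q = "{u, v, r, r'}"
  have d: "u \<noteq> r" "u \<noteq> r'" "v \<noteq> r" "v \<noteq> r'" using assms disjoint by auto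
  have "?Q - {u} = {v, r, r'}" "?Q - {v} = {u, r, r'}" "?Q - {r} = {u, v, r'}" "?Q - {r'} = {u, v, r}"
    using d assms(3,6) by auto
  then have cv: "\<forall>q\<in>?Q. q \<notin> convex hull (?Q - {q})" using assms(7-10) by auto
  then have "interior (convex hull ?Q) \<inter> (R \<union> B) = {}"
    using assms(11) vertex_notin_interior[of ?Q] by blast
  moreover have "card ?Q = 4" using d assms(3,6) by simp
  moreover have "?Q \<inter> R = {r, r'}" "?Q \<inter> B = {u, v}" using assms disjoint by auto
  ultimately have "balanced_convex_4hole R B ?Q"
    using cv assms(1-6) unfolding balanced_convex_4hole_def convex_4hole_def by simp
  then show ?thesis by blast
qed

text \<open>Both \<open>u v\<close> and \<open>r r'\<close> are sides of the hull, which makes all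
  four points vertices.\<close>

lemma same_side_hole:
  assumes "r \<in> R" "r' \<in> R" "u \<in> B" "v \<in> B"
    and "orient u v r * orient u v r' > 0" "orient r r' u * orient r r' v > 0"
    and "\<And>x. x \<in> R \<union> B \<Longrightarrow> x \<in> interior (convex hull {u, v, r, r'}) \<Longrightarrow> x \<in> {u, v, r, r'}"
  shows has_hole
proof (rule has_holeI[OF assms(1,2) _ assms(3,4) _ _ _ _ _ assms(7)])
  show "r \<noteq> r'" "u \<noteq> v" using assms(5,6) by auto
  show "u \<notin> convex hull {v, r, r'}" using same_side_vertex assms(5) by blast
  show "v \<notin> convex hull {u, r, r'}" using same_side_vertex[of v u r r'] assms(5) by (simp add: orient_swap[of v u])
  show "r \<notin> convex hull {u, v, r'}" using same_side_vertex[of r r' u v] assms(6) by (simp add: insert_commute)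
  show "r' \<notin> convex hull {u, v, r}" using same_side_vertex[of r' r u v] assms(6)
    by (simp add: orient_swap[of r' r] insert_commute)
qed

text \<open>Strong induction on the number of coloured points in the hull: an additional point
  \<open>p\<close> replaces a vertex of its own colour.\<close>

lemma crossing_hole:
  assumes "r \<in> R" "r' \<in> R" "b \<in> B" "b' \<in> B" "crossing r r' b b'"
  shows has_hole
  using assms
proof (induction "card ((R \<union> B) \<inter> convex hull {r, r', b, b'})" arbitrary: r r' b b' rule: less_induct)
  case less
  let ?Q = "{r, r', b, b'}"
  let ?m = "\<lambda>Q. card ((R \<union> B) \<inter> convex hull Q)"
  note cr = less.prems(5)
  have c: "crossing r' r b b'" "crossing b b' r r'" "crossing b' b r r'"
    using cr crossing_commute crossing_swap by blast+
  have vx: "r \<notin> convex hull {r', b, b'}" "r' \<notin> convex hull {r, b, b'}" "b \<notin> convex hull {b', r, r'}"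
    "b' \<notin> convex hull {b, r, r'}"
    using crossing_vertex cr c by blast+
  have ne: "r \<noteq> r'" "b \<noteq> b'" using cr unfolding crossing_def by auto
  have d: "r \<noteq> b" "r \<noteq> b'" "r' \<noteq> b" "r' \<noteq> b'" using less.prems disjoint by auto
  have fin: "finite (R \<union> B)" using finite_R finite_B by simp
  show ?case
  proof (cases "\<exists>p. p \<in> R \<union> B \<and> p \<in> convex hull ?Q \<and> p \<notin> ?Q")
    case False
    then show ?thesis
      using vx ne less.prems interior_subset[of "convex hull {b, b', r, r'}"]
      by (intro has_holeI[of r r' b b']) (auto simp: insert_commute)
  next
    case True
    then obtain p where p: "p \<in> R \<union> B" "p \<in> convex hull ?Q" "p \<notin> ?Q" by blast
    have sm: "?m {p, r', b, b'} < ?m ?Q" "?m {r, p, b, b'} < ?m ?Q" "?m {r, r', p, b'} < ?m ?Q"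
      "?m {r, r', b, p} < ?m ?Q"
    proof -
      have D: "?Q - {r} = {r', b, b'}" "?Q - {r'} = {r, b, b'}" "?Q - {b} = {b', r, r'}" "?Q - {b'} = {b, r, r'}"
        using ne d by auto
      show "?m {p, r', b, b'} < ?m ?Q"
        by (rule card_hull_exchange_less[of _ _ r, OF fin]) (use D vx p less.prems in auto)
      show "?m {r, p, b, b'} < ?m ?Q"
        by (rule card_hull_exchange_less[of _ _ r', OF fin]) (use D vx p less.prems in auto)
      show "?m {r, r', p, b'} < ?m ?Q"
        by (rule card_hull_exchange_less[of _ _ b, OF fin]) (use D vx p less.prems in auto)
      show "?m {r, r', b, p} < ?m ?Q"
        by (rule card_hull_exchange_less[of _ _ b', OF fin]) (use D vx p less.prems in auto)
    qed
    have nzp: "orient p x y \<noteq> 0" "orient x y p \<noteq> 0" if "x \<in> ?Q" "y \<in> ?Q" "x \<noteq> y" for x y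
    proof -
      have "x \<in> R \<union> B" "y \<in> R \<union> B" "p \<noteq> x" "p \<noteq> y" using that(1,2) p(3) less.prems by auto
      then show "orient p x y \<noteq> 0" "orient x y p \<noteq> 0" using orient_nonzero p(1) that(3) by metis+
    qed
    show ?thesis
    proof (cases "p \<in> R")
      case True
      \<comment> \<open>\<open>b b'\<close> separates \<open>r\<close> and \<open>r'\<close>, so
        \<open>p\<close> is opposite to one of them and replaces the other.\<close>
      have "orient b b' p * orient b b' r' < 0 \<or> orient b b' p * orient b b' r < 0"
        using nzp(2)[of b b'] ne c(2) unfolding crossing_def
        by (smt (verit, ccfv_SIG) crossing_def cr insertCI mult_less_0_iff)
      then show ?thesis
      proof
        assume "orient b b' p * orient b b' r' < 0"
        then have "crossing p r' b b'" using crossing_replace[OF cr p(2)] nzp(1) d by auto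
        then show ?thesis using less.hyps[OF sm(1)] True less.prems by blast
      next
        assume "orient b b' p * orient b b' r < 0"
        then have "crossing p r b b'" using crossing_replace[OF c(1), of p] nzp(1) d p(2)
          by (auto simp: insert_commute)
        then have "crossing r p b b'" using crossing_swap by blast
        then show ?thesis using less.hyps[OF sm(2)] True less.prems by blast
      qed
    next
      case False
      then have pB: "p \<in> B" using p by blast
      have "orient r r' p * orient r r' b' < 0 \<or> orient r r' p * orient r r' b < 0"
        using nzp(2)[of r r'] ne cr unfolding crossing_def
        by (smt (verit, ccfv_SIG) insertCI mult_less_0_iff)
      then show ?thesis
      proof
        assume "orient r r' p * orient r r' b' < 0"
        then have "crossing p b' r r'" using crossing_replace[OF c(2), of p] nzp(1) d p(2)
          by (auto simp: insert_commute)
        then have "crossing r r' p b'" using crossing_commute by blast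
        then show ?thesis using less.hyps[OF sm(3)] pB less.prems by blast
      next
        assume "orient r r' p * orient r r' b < 0"
        then have "crossing p b r r'" using crossing_replace[OF c(3), of p] nzp(1) d p(2)
          by (auto simp: insert_commute)
        then have "crossing r r' b p" using crossing_commute crossing_swap by blast
        then show ?thesis using less.hyps[OF sm(4)] pB less.prems by blast
      qed
    qed
  qed
qed

text \<open>A blue segment that leaves a red triangle crosses a side of it, which gives a
  hole.\<close>

lemma blue_in_triangle:
  assumes "\<not> has_hole" "a \<in> R" "b \<in> R" "c \<in> R" "distinct [a, b, c]"
    and "p \<in> B" "q \<in> B" "p \<in> convex hull {a, b, c}"
  shows "q \<in> convex hull {a, b, c}"
proof (rule ccontr)
  assume q: "q \<notin> convex hull {a, b, c}"
  then have "distinct [a, b, c, p, q]" using assms disjoint by auto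
  then have "crossing p q a b \<or> crossing p q b c \<or> crossing p q c a"
    using assms q by (intro triangle_exit[OF gen_pos]) auto
  then show False using crossing_hole assms(1-7) crossing_commute by metis
qed

section \<open>Holes beyond a blue edge\<close>

text \<open>The interior of the quadrilateral lies strictly beyond \<open>u v\<close>, where there
  is no blue point; the last hypothesis excludes further red ones.\<close>

lemma hole_beyond_edge:
  assumes "r \<in> R" "r' \<in> R" "u \<in> B" "v \<in> B"
    and "s * orient u v r > 0" "s * orient u v r' > 0" "orient r r' u * orient r r' v > 0"
    and "\<And>x. x \<in> B \<Longrightarrow> s * orient u v x \<le> 0"
    and "\<And>x. x \<in> R \<Longrightarrow> x \<in> convex hull {u, v, r, r'} \<Longrightarrow> s * orient u v x > 0 \<Longrightarrow> x \<in> {r, r'}"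
  shows has_hole
proof (rule same_side_hole[OF assms(1-4) _ assms(7)])
  show "orient u v r * orient u v r' > 0" using assms(5,6) by (auto simp: zero_less_mult_iff)
  fix x assume x: "x \<in> R \<union> B" "x \<in> interior (convex hull {u, v, r, r'})"
  have "u \<noteq> v" "s \<noteq> 0" using assms(5) by auto
  then have "s * orient u v x > 0" using assms(5,6) by (intro orient_pos_on_interior_hull[OF _ _ _ x(2)]) auto
  then show "x \<in> {u, v, r, r'}" using assms(8,9)[of x] x interior_subset by fastforce
qed

text \<open>The blue points lie on one side of \<open>a b\<close>, a side of the triangle, which
  gives convex position.\<close>

lemma hole_beyond_edge_in_triangle:
  assumes "a \<in> R" "b \<in> R" "c \<in> R" "distinct [a, b, c]" "B \<subseteq> convex hull {a, b, c}"
    and "R \<inter> convex hull {a, b, c} \<subseteq> {a, b, c}" "u \<in> B" "v \<in> B"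
    and "\<And>x. x \<in> B \<Longrightarrow> s * orient u v x \<le> 0" "s * orient u v a > 0" "s * orient u v b > 0"
  shows has_hole
proof (rule hole_beyond_edge[OF assms(1,2,7,8,10,11) _ assms(9)])
  have "orient a b c \<noteq> 0" using assms by (intro orient_nonzero) auto
  then obtain t :: real where t: "t * orient a b c > 0" "t \<noteq> 0"
    by (metis linorder_neqE_linordered_idom mult_neg_neg mult_pos_pos zero_less_one less_irrefl
        neg_less_0_iff_less)
  have "t * orient a b x > 0" if "x \<in> B" for x
  proof -
    have "orient a b x \<noteq> 0" using assms that disjoint by (intro orient_nonzero) auto
    then show ?thesis using in_triangle_iff[OF t(1), of x] that assms(5) t(2) by (auto simp: order_less_le)
  qed
  then have "(t * orient a b u) * (t * orient a b v) > 0" using assms(7,8) by simp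
  then show "orient a b u * orient a b v > 0"
    by (smt (verit, ccfv_SIG) mult_less_0_iff zero_less_mult_iff)
next
  fix x assume x: "x \<in> R" "x \<in> convex hull {u, v, a, b}" "s * orient u v x > 0"
  have "{u, v, a, b} \<subseteq> convex hull {a, b, c}" using assms(5,7,8) hull_subset[of "{a, b, c}" convex] by auto
  then have "x \<in> convex hull {a, b, c}" using x(2) hull_minimal convex_convex_hull by blast
  \<comment> \<open>Otherwise the whole triangle, with \<open>u\<close> in it, would lie strictly
    beyond \<open>u v\<close>.\<close>
  moreover have "x \<noteq> c"
  proof
    assume "x = c"
    then have "s * orient u v u > 0"
      using orient_pos_on_hull[of "{a, b, c}" s u v u] assms x by auto
    then show False by simp
  qed
  ultimately show "x \<in> {a, b}" using x(1) assms(6) by blast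
qed

end

lemma general_position_subset: "general_position S \<Longrightarrow> T \<subseteq> S \<Longrightarrow> general_position T"
  unfolding general_position_def by blast

lemma mult_pos_same_sign:
  fixes x y t :: real
  assumes "t * x > 0" "t * y > 0"
  shows "x * y > 0"
  using assms by (auto simp: zero_less_mult_iff)

lemma mult_pos_opposite_side:
  fixes x y z :: real
  assumes "x * y < 0" "\<not> x * z > 0" "z \<noteq> 0"
  shows "y * z > 0"
  using assms unfolding mult_less_0_iff zero_less_mult_iff by linarith

context bicoloured
begin

subsection \<open>Four red points around the blue points\<close>

text \<open>\<open>r1, r3, r2, r4\<close> is a convex quadrilateral in this cyclic order, with the
  blue points on the side of \<open>r1\<close> of its diagonal \<open>r3 r4\<close>. An edge that
  sees \<open>r2\<close> but neither \<open>r1\<close> nor \<open>r3\<close> also sees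
  \<open>r4\<close>, and \<open>r2 r4\<close> is a side.\<close>

lemma hole_quadrilateral:
  assumes r: "r1 \<in> R" "r2 \<in> R" "r3 \<in> R" "r4 \<in> R" "distinct [r1, r2, r3, r4]"
    and T: "B \<subseteq> convex hull {r1, r2, r3}" and T': "B \<subseteq> convex hull {r1, r3, r4}"
    and only: "R \<inter> convex hull {r1, r2, r3, r4} \<subseteq> {r1, r2, r3, r4}" "r4 \<notin> convex hull {r1, r2, r3}"
    and r4: "r4 = l1 *\<^sub>R r1 + l2 *\<^sub>R r2 + l3 *\<^sub>R r3" "l1 + l2 + l3 = 1" "l1 > 0" "l2 > 0" "l3 < 0"
    and card: "card B \<ge> 2"
  shows has_hole
proof -
  note r4o = orient_convex_comb[OF r4(2), of _ _ r1 r2 r3, folded r4(1)]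
  have Bd: "r1 \<notin> B" "r2 \<notin> B" "r3 \<notin> B" "r4 \<notin> B" using r disjoint by auto
  have only3: "R \<inter> convex hull {r1, r2, r3} \<subseteq> {r1, r2, r3}"
    using only hull_mono[of "{r1, r2, r3}" "{r1, r2, r3, r4}" convex] by blast
  define s where "s = orient r3 r4 r1"
  have s0: "s \<noteq> 0" unfolding s_def by (rule orient_nonzero) (use r in auto)
  \<comment> \<open>The determinant with \<open>r3 r4\<close> vanishes at \<open>r3\<close> and
    \<open>r4\<close>, so the positive weights put \<open>r1\<close> and \<open>r2\<close> on
    opposite sides of this diagonal.\<close>
  have "l1 * s + l2 * orient r3 r4 r2 = 0" using r4o[of r3 r4] s_def by simp
  then have "l2 * (s * orient r3 r4 r2) = - l1 * (s * s)" by algebra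
  then have "l2 * (s * orient r3 r4 r2) < 0" using s0 r4(3)
    by (metis mult_minus_left mult_pos_pos neg_less_0_iff_less not_real_square_gt_zero)
  then have neg: "s * orient r3 r4 r2 < 0" using r4(4) by (simp add: mult_less_0_iff)
  have "r2 \<notin> convex hull B"
  proof
    assume "r2 \<in> convex hull B"
    then have "r2 \<in> convex hull {r1, r3, r4}" using T' hull_minimal convex_convex_hull by blast
    then have "s * orient r3 r4 r2 \<ge> 0" by (rule orient_nonneg_on_hull[rotated]) (auto simp: s_def)
    then show False using neg by simp
  qed
  moreover have "general_position (insert r2 B)" using general_position_subset[OF gen_pos] r by blast
  ultimately obtain u v where uv: "u \<in> B" "v \<in> B" "u \<noteq> v" "orient u v r2 > 0"
    "\<And>b. b \<in> B \<Longrightarrow> orient u v b \<le> 0"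
    using visible_edge[OF finite_B] card by metis
  have ble: "1 * orient u v b \<le> 0" if "b \<in> B" for b using uv(5) that by simp
  show ?thesis
  proof (cases "orient u v r1 > 0 \<or> orient u v r3 > 0")
    case True
    then show ?thesis
    proof
      assume "orient u v r1 > 0"
      then show ?thesis using hole_beyond_edge_in_triangle[of r1 r2 r3 u v 1] r T only3 uv by auto
    next
      assume "orient u v r3 > 0"
      then show ?thesis using hole_beyond_edge_in_triangle[of r2 r3 r1 u v 1] r T only3 uv
        by (auto simp: insert_commute)
    qed
  next
    case False
    have "orient u v r1 \<noteq> 0" "orient u v r3 \<noteq> 0" "orient u v r4 \<noteq> 0"
      by (rule orient_nonzero; use uv r Bd in auto)+
    then have f: "orient u v r1 < 0" "orient u v r3 < 0" using False by auto
    \<comment> \<open>Otherwise the triangle \<open>r1 r3 r4\<close>, with \<open>u\<close> in it,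
      would lie strictly on the inner side of \<open>u v\<close>.\<close>
    have f4: "orient u v r4 > 0"
    proof (rule ccontr)
      assume n: "\<not> ?thesis"
      have "(-1) * orient u v u > 0"
        by (rule orient_pos_on_hull[of "{r1, r3, r4}"]) (use n f \<open>orient u v r4 \<noteq> 0\<close> T' uv(1) in auto)
      then show False by simp
    qed
    \<comment> \<open>This sign puts \<open>r1\<close>, \<open>r3\<close> and hence the blue points
      on the nonnegative side of \<open>r2 r4\<close>.\<close>
    define t where "t = - orient r2 r3 r1"
    have t0: "t \<noteq> 0" unfolding t_def using orient_nonzero[of r2 r3 r1] r by auto
    have "orient r2 r4 r1 = l3 * orient r2 r3 r1" "orient r2 r4 r3 = - l1 * orient r2 r3 r1"
    proof -
      have "orient r2 r4 r1 = orient r1 r2 r4" "orient r2 r4 r3 = orient r3 r2 r4"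
        "orient r1 r2 r3 = orient r2 r3 r1" "orient r3 r2 r1 = - orient r2 r3 r1"
        by (simp_all add: orient_def algebra_simps)
      then show "orient r2 r4 r1 = l3 * orient r2 r3 r1" "orient r2 r4 r3 = - l1 * orient r2 r3 r1"
        using r4o[of r1 r2] r4o[of r3 r2] by auto
    qed
    then have o: "t * orient r2 r4 r1 = - l3 * (t * t)" "t * orient r2 r4 r3 = l1 * (t * t)"
      unfolding t_def by auto
    then have o': "t * orient r2 r4 r1 \<ge> 0" "t * orient r2 r4 r3 \<ge> 0"
      using r4(3,5) mult_nonpos_nonneg[of l3 "t * t"] mult_nonneg_nonneg[of l1 "t * t"] zero_le_square[of t]
      by linarith+
    have pos: "t * orient r2 r4 x > 0" if "x \<in> B" for x
    proof -
      have "x \<in> convex hull {r1, r3, r4}" using that T' by blast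
      then have "t * orient r2 r4 x \<ge> 0"
        by (rule orient_nonneg_on_hull[rotated]) (use o' in auto)
      moreover have "orient r2 r4 x \<noteq> 0" by (rule orient_nonzero) (use that r Bd in auto)
      ultimately show ?thesis using t0 by (simp add: order_less_le)
    qed
    show ?thesis
    proof (rule hole_beyond_edge[OF r(2,4) uv(1,2) _ _ mult_pos_same_sign[OF pos pos] ble])
      show "1 * orient u v r2 > 0" "1 * orient u v r4 > 0" using uv f4 by auto
      fix x assume x: "x \<in> R" "x \<in> convex hull {u, v, r2, r4}" "1 * orient u v x > 0"
      have "{u, v, r2, r4} \<subseteq> convex hull {r1, r2, r3, r4}"
        using T uv(1,2) hull_mono[of "{r1, r2, r3}" "{r1, r2, r3, r4}" convex]
          hull_subset[of "{r1, r2, r3, r4}" convex] by auto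
      then have "x \<in> convex hull {r1, r2, r3, r4}" using x(2) hull_minimal convex_convex_hull by blast
      then show "x \<in> {r2, r4}" using x f only by auto
    qed (use uv in auto)
  qed
qed

text \<open>The sign \<open>\<sigma>\<close> allows the end points \<open>u\<close> and \<open>v\<close> of the edge to change roles.\<close>
lemma hole_cone_split:
  assumes r: "r1 \<in> R" "r2 \<in> R" "r3 \<in> R" "r4 \<in> R" "distinct [r1, r2, r3, r4]"
    and T: "B \<subseteq> convex hull {r1, r2, r3}"
    and only: "R \<inter> convex hull {r1, r2, r3, r4} \<subseteq> {r1, r2, r3, r4}"
    and r4: "r4 = (1 + \<alpha> + \<beta>) *\<^sub>R r1 + (- \<alpha>) *\<^sub>R r2 + (- \<beta>) *\<^sub>R r3" "\<alpha> > 0" "\<beta> > 0"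
    and \<sigma>: "\<sigma> * \<sigma> = (1::real)" and uv: "u \<in> B" "v \<in> B"
    and edge: "\<And>x. x \<in> B \<Longrightarrow> \<sigma> * orient u v x \<le> 0"
    and f: "\<sigma> * orient u v r1 > 0" "\<sigma> * orient u v r2 < 0" "\<sigma> * orient u v r3 < 0"
    and split: "orient r1 r4 v * orient r1 r4 u < 0"
    and z: "z \<in> B" "z \<noteq> v" "orient r1 r4 v * orient r1 r4 z > 0"
    and r3: "orient r1 r4 v * orient r1 r4 r3 > 0"
  shows has_hole
proof -
  have sum1: "(1 + \<alpha> + \<beta>) + (- \<alpha>) + (- \<beta>) = 1" by simp
  note r4o = orient_convex_comb[OF sum1, of _ _ r1 r2 r3, folded r4(1)]
  have Bd: "r1 \<notin> B" "r2 \<notin> B" "r3 \<notin> B" "r4 \<notin> B" using r disjoint by auto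
  \<comment> \<open>The sign of \<open>t\<close> names the side of the line \<open>r1 r4\<close>
    that contains \<open>v\<close>, \<open>z\<close> and \<open>r3\<close>; \<open>u\<close> and
    \<open>r2\<close> lie on the other.\<close>
  define t where "t = orient r1 r4 v"
  have t0: "t \<noteq> 0" using split t_def by auto
  have \<sigma>0: "\<sigma> \<noteq> 0" using \<sigma> by auto
  have K: "\<alpha> * orient r1 r4 r2 + \<beta> * orient r1 r4 r3 = 0" using r4o[of r1 r4] by simp
  have k2: "t * orient r1 r4 r2 < 0"
  proof -
    have "\<alpha> * (t * orient r1 r4 r2) = - \<beta> * (t * orient r1 r4 r3)" using K by algebra
    then have "\<alpha> * (t * orient r1 r4 r2) < 0" using r3 r4(3) t_def by (simp add: mult_neg_pos)
    then show ?thesis using r4(2) by (simp add: mult_less_0_iff)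
  qed
  \<comment> \<open>\<open>r1\<close> is a weighted mean of \<open>r2\<close>, \<open>r3\<close>,
    \<open>r4\<close>: an affine function larger at \<open>r1\<close> than at \<open>r2\<close> and
    \<open>r3\<close> is larger still at \<open>r4\<close>.\<close>
  have gt: "f4 = (1 + \<alpha> + \<beta>) * f1 - \<alpha> * f2 - \<beta> * f3 \<Longrightarrow> f1 > 0 \<Longrightarrow> f2 < 0 \<Longrightarrow> f3 < 0 \<Longrightarrow> f4 > f1"
    for f1 f2 f3 f4
  proof -
    assume a: "f4 = (1 + \<alpha> + \<beta>) * f1 - \<alpha> * f2 - \<beta> * f3" "f1 > 0" "f2 < 0" "f3 < 0"
    have "f4 - f1 = \<alpha> * (f1 - f2) + \<beta> * (f1 - f3)" using a(1) by algebra
    moreover have "\<alpha> * (f1 - f2) > 0" "\<beta> * (f1 - f3) > 0" using a r4(2,3) by auto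
    ultimately show "f4 > f1" by linarith
  qed
  have f41: "\<sigma> * orient u v r4 > \<sigma> * orient u v r1"
    by (rule gt[OF _ f]) (simp add: r4o algebra_simps)
  then have f4: "\<sigma> * orient u v r4 > 0" using f(1) by linarith
  \<comment> \<open>Up to the factor \<sigma>: going from \<open>r1\<close> to \<open>r4\<close>
    leads away from \<open>u v\<close>. The gain equals the difference of the values at
    \<open>u\<close> and \<open>v\<close> of the determinant with \<open>r1 r4\<close>; these differ
    in sign, so that at \<open>v\<close> is negative.\<close>
  have \<sigma>t: "\<sigma> * t < 0"
  proof -
    have "\<sigma> * orient u v r4 - \<sigma> * orient u v r1 = \<sigma> * orient r1 r4 u - \<sigma> * t"
      unfolding t_def by (simp add: orient_def algebra_simps)
    then have a: "\<sigma> * t < \<sigma> * orient r1 r4 u" using f41 by linarith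
    have "(\<sigma> * t) * (\<sigma> * orient r1 r4 u) = (\<sigma> * \<sigma>) * (t * orient r1 r4 u)" by algebra
    also have "\<dots> < 0" using split unfolding t_def \<sigma> by simp
    finally have "(\<sigma> * t) * (\<sigma> * orient r1 r4 u) < 0" .
    then show ?thesis using a by (auto simp: mult_less_0_iff)
  qed
  let ?T = "convex hull {r2, r3, r4}"
  have r1T: "r1 \<in> ?T"
  proof -
    let ?d = "1 + \<alpha> + \<beta>"
    have d: "?d > 0" using r4 by auto
    have "?d *\<^sub>R r1 = \<alpha> *\<^sub>R r2 + \<beta> *\<^sub>R r3 + 1 *\<^sub>R r4" unfolding r4(1) by (simp add: algebra_simps)
    then have "(1 / ?d) *\<^sub>R (?d *\<^sub>R r1) = (1 / ?d) *\<^sub>R (\<alpha> *\<^sub>R r2 + \<beta> *\<^sub>R r3 + 1 *\<^sub>R r4)" by simp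
    then have "r1 = (\<alpha> / ?d) *\<^sub>R r2 + (\<beta> / ?d) *\<^sub>R r3 + (1 / ?d) *\<^sub>R r4"
      using d by (simp add: scaleR_add_right)
    moreover have "\<alpha> / ?d + \<beta> / ?d + 1 / ?d = 1" using d
      by (metis add.commute add.left_commute add_divide_distrib divide_self less_irrefl)
    moreover have "\<alpha> / ?d \<ge> 0" "\<beta> / ?d \<ge> 0" "1 / ?d \<ge> 0" using r4 d by auto
    ultimately show ?thesis unfolding convex_hull_3 by blast
  qed
  have rT: "r2 \<in> ?T" "r3 \<in> ?T" "r4 \<in> ?T" by (simp_all add: hull_inc)
  have "convex hull {r1, r2, r3} \<subseteq> ?T" using r1T rT by (intro hull_minimal) auto
  then have BT: "B \<subseteq> ?T" using T by blast
  have "?T \<subseteq> convex hull {r1, r2, r3, r4}" by (intro hull_mono) auto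
  then have onlyT: "R \<inter> ?T \<subseteq> {r1, r2, r3, r4}" using only by blast
  define s3 where "s3 = orient r3 r4 r2"
  have s3: "s3 \<noteq> 0" unfolding s3_def by (rule orient_nonzero) (use r in auto)
  have s3T: "s3 * orient r3 r4 x \<ge> 0" if "x \<in> ?T" for x
    using that by (rule orient_nonneg_on_hull[rotated]) (auto simp: s3_def)
  \<comment> \<open>All of \<open>X\<close> lies on one side of \<open>u v\<close>, so
    \<open>v\<close> sees it in a linear angular order, with extremes \<open>w\<close> and
    \<open>w'\<close>.\<close>
  define X where "X = {x \<in> B - {v}. t * orient r1 r4 x > 0}"
  have X: "finite X" "X \<noteq> {}" proof -
    have "z \<in> X" using z by (simp add: X_def t_def)
    then show "X \<noteq> {}" by blast
  qed (use finite_B X_def in auto)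
  have XB: "x \<in> B" "x \<noteq> v" "x \<noteq> u" "t * orient r1 r4 x > 0" if "x \<in> X" for x
    using that split by (auto simp: X_def t_def)
  have uv': "u \<noteq> v" using f by auto
  have fX: "\<sigma> * orient u v x < 0" if "x \<in> X" for x
  proof -
    have "orient u v x \<noteq> 0" by (rule orient_nonzero) (use XB[OF that] uv uv' in auto)
    then show ?thesis using edge XB(1)[OF that] \<sigma>0 by (simp add: order_less_le)
  qed
  then have fX': "(-\<sigma>) * orient u v x > 0" if "x \<in> X" for x using that by fastforce
  obtain w where w: "w \<in> X" "\<And>x. x \<in> X \<Longrightarrow> \<sigma> * orient v w x \<le> 0"
    using angular_extreme_orient[OF X fX'] by metis
  obtain w' where w': "w' \<in> X" "\<And>x. x \<in> X \<Longrightarrow> (-\<sigma>) * orient v w' x \<le> 0"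
    using angular_extreme_orient[OF X fX'] by metis
  \<comment> \<open>The quadrilaterals below lie in the triangle \<open>r2 r3 r4\<close> on the
    closed side of \<open>v\<close>. There, \<open>r1\<close> and \<open>r4\<close> are on the line,
    \<open>r2\<close> is behind it and \<open>r3\<close> on the border, so no red point is
    interior.\<close>
  have only_X: "y = v \<or> y \<in> X"
    if "Q \<subseteq> ?T" "\<And>x. x \<in> Q \<Longrightarrow> t * orient r1 r4 x \<ge> 0" "y \<in> R \<union> B" "y \<in> interior (convex hull Q)" for Q y
  proof -
    have k: "t * orient r1 r4 y > 0"
      by (rule orient_pos_on_interior_hull[of Q]) (use that(2,4) r(5) t0 in auto)
    show ?thesis
    proof (cases "y \<in> B")
      case True
      then show ?thesis using k X_def by auto
    next
      case False
      then have yR: "y \<in> R" using that by auto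
      have hq: "convex hull Q \<subseteq> ?T" using that(1) by (simp add: hull_minimal)
      then have "y \<in> ?T" using that(4) interior_subset by blast
      then have "y = r3" using yR onlyT k k2 by auto
      moreover have "s3 * orient r3 r4 y > 0"
        by (rule orient_pos_on_interior_hull[of Q]) (use that(1,4) s3T s3 r(5) in auto)
      ultimately show ?thesis by simp
    qed
  qed
  have hole14: has_hole
    if c: "c \<in> X" and s: "s \<noteq> 0" "\<And>x. x \<in> X \<Longrightarrow> s * orient v c x \<le> 0"
      and g: "s * orient v c r1 > 0" "s * orient v c r4 > 0" for c s
  proof (rule same_side_hole[OF r(1,4) uv(2) XB(1)[OF c] mult_pos_same_sign[OF g]])
    show "orient r1 r4 v * orient r1 r4 c > 0" using XB(4)[OF c] t_def by simp
    fix y assume y: "y \<in> R \<union> B" "y \<in> interior (convex hull {v, c, r1, r4})"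
    have "t * orient r1 r4 v > 0" using t0 t_def by (simp add: order_less_le)
    then have "y = v \<or> y \<in> X"
      using XB[OF c] uv BT r1T rT by (intro only_X[OF _ _ y]) auto
    moreover have "s * orient v c y > 0"
      using s(1) g XB(2)[OF c] by (intro orient_pos_on_interior_hull[OF _ _ _ y(2)]) auto
    ultimately show "y \<in> {v, c, r1, r4}" using s(2)[of y] by auto
  qed
  have vw: "v \<noteq> w" "w \<in> B" using XB[OF w(1)] by auto
  have "orient v w r1 \<noteq> 0" "orient v w r4 \<noteq> 0" "orient v w r3 \<noteq> 0"
    by (rule orient_nonzero; use uv r Bd vw in auto)+
  then have g0: "\<sigma> * orient v w r1 \<noteq> 0" "\<sigma> * orient v w r4 \<noteq> 0" "\<sigma> * orient v w r3 \<noteq> 0"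
    using \<sigma>0 by auto
  \<comment> \<open>The line \<open>v w\<close> has \<open>X\<close> on one closed side; the cases
    say which of \<open>r1\<close> and \<open>r4\<close> are beyond it.\<close>
  consider "\<sigma> * orient v w r1 > 0" "\<sigma> * orient v w r4 > 0" | "\<sigma> * orient v w r1 > 0" "\<sigma> * orient v w r4 < 0"
    | "\<sigma> * orient v w r1 < 0" "\<sigma> * orient v w r4 > 0" | "\<sigma> * orient v w r1 < 0" "\<sigma> * orient v w r4 < 0"
    using g0 by linarith
  then show ?thesis
  proof cases
    case 1
    then show ?thesis using hole14[OF w(1) \<sigma>0 w(2)] by blast
  next
    case 2
    \<comment> \<open>Pluecker relation at \<open>v\<close>: the left side is negative and the right
      side positive, so this case cannot occur.\<close>
    have "(\<sigma> * orient u v r1) * (\<sigma> * orient v w r4) - (\<sigma> * orient u v r4) * (\<sigma> * orient v w r1)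
        = (\<sigma> * orient u v w) * (\<sigma> * t)"
      unfolding t_def by (simp add: orient_def algebra_simps)
    moreover have "(\<sigma> * orient u v w) * (\<sigma> * t) > 0" using fX[OF w(1)] \<sigma>t by (rule mult_neg_neg)
    moreover have "(\<sigma> * orient u v r1) * (\<sigma> * orient v w r4) < 0" using f(1) 2(2) by (rule mult_pos_neg)
    moreover have "(\<sigma> * orient u v r4) * (\<sigma> * orient v w r1) > 0" using f4 2(1) by (rule mult_pos_pos)
    ultimately show ?thesis by linarith
  next
    case 3
    obtain a1 a2 a3 where a: "v = a1 *\<^sub>R r1 + a2 *\<^sub>R r2 + a3 *\<^sub>R r3" "a1 + a2 + a3 = 1"
      "0 \<le> a1" "0 \<le> a2" "0 \<le> a3" using T uv(2) unfolding convex_hull_3 by blast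
    note vo = orient_convex_comb[OF a(2), of _ _ r1 r2 r3, folded a(1)]
    have "t = a2 * orient r1 r4 r2 + a3 * orient r1 r4 r3" using vo[of r1 r4] t_def by simp
    then have "(\<alpha> * a3 - \<beta> * a2) * (orient r1 r4 r3 * orient r1 r4 r3) = \<alpha> * (t * orient r1 r4 r3)"
      using K by algebra
    moreover have "\<alpha> * (t * orient r1 r4 r3) > 0" using r3 r4(2) t_def by simp
    moreover have "orient r1 r4 r3 * orient r1 r4 r3 \<ge> 0" by simp
    \<comment> \<open>In barycentric coordinates, \<open>v\<close> lies on the side of
      \<open>r3\<close>.\<close>
    ultimately have d: "\<alpha> * a3 - \<beta> * a2 > 0" by (metis mult_nonpos_nonneg not_less)
    define g where "g x = \<sigma> * orient v w x" for x
    have gv: "a1 * g r1 + a2 * g r2 + a3 * g r3 = 0"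
    proof -
      have "\<sigma> * orient v w v = \<sigma> * (a1 * orient v w r1 + a2 * orient v w r2 + a3 * orient v w r3)"
        unfolding vo[of v w] ..
      then show ?thesis unfolding g_def by (simp add: algebra_simps)
    qed
    have g4: "g r4 = (1 + \<alpha> + \<beta>) * g r1 - \<alpha> * g r2 - \<beta> * g r3"
      unfolding g_def r4o by (simp add: algebra_simps)
    \<comment> \<open>The hole of this case uses \<open>r3\<close> and \<open>r4\<close>. If
      \<open>r3\<close> were not beyond \<open>v w\<close>, eliminating \<open>g r2\<close> from
      \<open>gv\<close> and \<open>g4\<close> would make \<open>a2 * g r4\<close> negative.\<close>
    have g3: "g r3 > 0"
    proof (rule ccontr)
      assume "\<not> ?thesis"
      then have n: "g r3 < 0" using g0(3) unfolding g_def by linarith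
      have "a2 * g r4 = (a2 * (1 + \<alpha> + \<beta>) + \<alpha> * a1) * g r1 + (\<alpha> * a3 - \<beta> * a2) * g r3"
        using gv g4 by algebra
      moreover have "a2 * g r4 \<ge> 0" using a 3 g_def by simp
      moreover have "(a2 * (1 + \<alpha> + \<beta>) + \<alpha> * a1) * g r1 \<le> 0"
        using a r4 3 g_def by (intro mult_nonneg_nonpos) auto
      moreover have "(\<alpha> * a3 - \<beta> * a2) * g r3 < 0" using d n by (rule mult_pos_neg)
      ultimately show False by linarith
    qed
    have s3p: "s3 * orient r3 r4 x > 0" if "x \<in> B" for x
    proof -
      have "orient r3 r4 x \<noteq> 0" by (rule orient_nonzero) (use that r Bd in auto)
      then show ?thesis using s3T[of x] BT that s3 by (auto simp: order_less_le)
    qed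
    show ?thesis
    proof (rule same_side_hole[OF r(3,4) uv(2) vw(2)])
      show "orient v w r3 * orient v w r4 > 0"
        using mult_pos_same_sign[OF g3[unfolded g_def] 3(2)] .
      show "orient r3 r4 v * orient r3 r4 w > 0"
        using mult_pos_same_sign[OF s3p s3p] uv(2) vw(2) by blast
      fix y assume y: "y \<in> R \<union> B" "y \<in> interior (convex hull {v, w, r3, r4})"
      have "t * orient r1 r4 v > 0" using t0 t_def by (simp add: order_less_le)
      then have "y = v \<or> y \<in> X"
        using XB[OF w(1)] uv BT rT r3 t_def by (intro only_X[OF _ _ y]) auto
      moreover have "\<sigma> * orient v w y > 0"
        using \<sigma>0 g3 3 g_def vw by (intro orient_pos_on_interior_hull[OF _ _ _ y(2)]) auto
      ultimately show "y \<in> {v, w, r3, r4}" using w(2)[of y] by auto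
    qed
  next
    case 4
    \<comment> \<open>The Pluecker relation again: a point beyond \<open>u v\<close> but not beyond
      \<open>v w\<close> is beyond \<open>v w'\<close>, so the other extreme serves.\<close>
    have "(-\<sigma>) * orient v w' q > 0" if q: "\<sigma> * orient v w q < 0" "\<sigma> * orient u v q > 0" for q
    proof -
      have "(\<sigma> * orient u v w) * (\<sigma> * orient v w' q)
        = (\<sigma> * orient u v w') * (\<sigma> * orient v w q) - (\<sigma> * orient u v q) * (\<sigma> * orient v w w')"
        by (simp add: orient_def algebra_simps)
      moreover have "(\<sigma> * orient u v w') * (\<sigma> * orient v w q) > 0"
        using fX[OF w'(1)] q(1) by (rule mult_neg_neg)
      moreover have "(\<sigma> * orient u v q) * (\<sigma> * orient v w w') \<le> 0"
        using q(2) w(2)[OF w'(1)] by (simp add: mult_nonneg_nonpos)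
      ultimately have "(\<sigma> * orient u v w) * (\<sigma> * orient v w' q) > 0" by linarith
      then have "\<sigma> * orient v w' q < 0" using fX[OF w(1)]
        by (metis less_asym zero_less_mult_iff)
      then show ?thesis by simp
    qed
    then show ?thesis using hole14[OF w'(1) _ w'(2)] \<sigma>0 4 f(1) f4 by (metis neg_equal_0_iff_equal)
  qed
qed


text \<open>\<open>r4\<close> lies behind the corner \<open>r1\<close>, hence beyond each edge that
  sees \<open>r1\<close> as its only corner. If the line \<open>r1 r4\<close> does not separate the
  ends of the edge, these form a hole with \<open>r1\<close> and \<open>r4\<close>; otherwise
  \<open>hole_cone_split\<close> rotates about one end.\<close>

lemma hole_cone:
  assumes r: "r1 \<in> R" "r2 \<in> R" "r3 \<in> R" "r4 \<in> R" "distinct [r1, r2, r3, r4]"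
    and T: "B \<subseteq> convex hull {r1, r2, r3}"
    and only: "R \<inter> convex hull {r1, r2, r3, r4} \<subseteq> {r1, r2, r3, r4}" "r4 \<notin> convex hull {r1, r2, r3}"
    and r4: "r4 = (1 + \<alpha> + \<beta>) *\<^sub>R r1 + (- \<alpha>) *\<^sub>R r2 + (- \<beta>) *\<^sub>R r3" "\<alpha> > 0" "\<beta> > 0"
    and card: "card B \<ge> 2"
  shows has_hole
proof -
  have sum1: "(1 + \<alpha> + \<beta>) + (- \<alpha>) + (- \<beta>) = 1" by simp
  note r4o = orient_convex_comb[OF sum1, of _ _ r1 r2 r3, folded r4(1)]
  have Bd: "r1 \<notin> B" "r2 \<notin> B" "r3 \<notin> B" "r4 \<notin> B" using r disjoint by auto
  have only3: "R \<inter> convex hull {r1, r2, r3} \<subseteq> {r1, r2, r3}"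
    using only hull_mono[of "{r1, r2, r3}" "{r1, r2, r3, r4}" convex] by blast
  have "r1 \<notin> convex hull B"
  proof
    assume a: "r1 \<in> convex hull B"
    have o: "orient r1 r2 r3 \<noteq> 0" by (rule orient_nonzero) (use r in auto)
    have "orient r1 r2 r3 * orient r1 r2 x > 0" if "x \<in> B" for x
    proof -
      have "orient r1 r2 r3 * orient r1 r2 x \<ge> 0"
        by (rule orient_nonneg_on_hull[of "{r1, r2, r3}"]) (use that T in auto)
      moreover have "orient r1 r2 x \<noteq> 0" by (rule orient_nonzero) (use that Bd r in auto)
      ultimately show ?thesis using o by (simp add: order_less_le)
    qed
    then have "orient r1 r2 r3 * orient r1 r2 r1 > 0" by (rule orient_pos_on_hull[OF _ a])
    then show False by simp
  qed
  moreover have "general_position (insert r1 B)" using general_position_subset[OF gen_pos] r by blast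
  ultimately obtain u v where uv: "u \<in> B" "v \<in> B" "u \<noteq> v" "orient u v r1 > 0"
    "\<And>b. b \<in> B \<Longrightarrow> orient u v b \<le> 0"
    using visible_edge[OF finite_B] card by metis
  show ?thesis
  proof (cases "orient u v r2 > 0 \<or> orient u v r3 > 0")
    case True
    then show ?thesis
    proof
      assume "orient u v r2 > 0"
      then show ?thesis using hole_beyond_edge_in_triangle[of r1 r2 r3 u v 1] r T only3 uv by auto
    next
      assume "orient u v r3 > 0"
      then show ?thesis using hole_beyond_edge_in_triangle[of r1 r3 r2 u v 1] r T only3 uv
        by (auto simp: insert_commute)
    qed
  next
    case False
    have "orient u v r2 \<noteq> 0" "orient u v r3 \<noteq> 0"
      by (rule orient_nonzero; use uv r Bd in auto)+
    then have f: "orient u v r2 < 0" "orient u v r3 < 0" using False by auto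
    have f4: "orient u v r4 > 0"
    proof -
      have "orient u v r4 = (1 + \<alpha> + \<beta>) * orient u v r1 + (-\<alpha>) * orient u v r2 + (-\<beta>) * orient u v r3"
        by (rule r4o)
      moreover have "(1 + \<alpha> + \<beta>) * orient u v r1 > 0" using r4 uv by simp
      moreover have "(-\<alpha>) * orient u v r2 > 0" "(-\<beta>) * orient u v r3 > 0" using r4 f by (auto simp: mult_pos_neg)
      ultimately show ?thesis by linarith
    qed
    have K: "\<alpha> * orient r1 r4 r2 + \<beta> * orient r1 r4 r3 = 0" using r4o[of r1 r4] by simp
    have K0: "orient r1 r4 r2 \<noteq> 0" "orient r1 r4 r3 \<noteq> 0" "orient r1 r4 u \<noteq> 0" "orient r1 r4 v \<noteq> 0"
      by (rule orient_nonzero; use uv r Bd in auto)+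
    show ?thesis
    proof (cases "orient r1 r4 u * orient r1 r4 v > 0")
      case True
      show ?thesis
      proof (rule hole_beyond_edge[OF r(1,4) uv(1,2) _ _ True])
        show "1 * orient u v r1 > 0" "1 * orient u v r4 > 0" using uv f4 by auto
        show "1 * orient u v x \<le> 0" if "x \<in> B" for x using uv that by auto
        fix x assume x: "x \<in> R" "x \<in> convex hull {u, v, r1, r4}" "1 * orient u v x > 0"
        have "{u, v, r1, r4} \<subseteq> convex hull {r1, r2, r3, r4}"
          using T uv(1,2) hull_mono[of "{r1, r2, r3}" "{r1, r2, r3, r4}" convex]
            hull_subset[of "{r1, r2, r3, r4}" convex] by auto
        then have "x \<in> convex hull {r1, r2, r3, r4}" using x(2) hull_minimal convex_convex_hull by blast
        then show "x \<in> {r1, r4}" using x f only by auto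
      qed
    next
      case False
      then have split: "orient r1 r4 v * orient r1 r4 u < 0"
        using K0 by (metis linorder_neqE_linordered_idom mult.commute mult_eq_0_iff)
      show ?thesis
      proof (cases "B \<subseteq> {u, v}")
        case True
        \<comment> \<open>With two blue points only, \<open>u v\<close> is an edge on both sides,
          and the other side sees \<open>r2\<close> and \<open>r3\<close>.\<close>
        then have "(-1) * orient u v x \<le> 0" if "x \<in> B" for x using that by fastforce
        then show ?thesis using hole_beyond_edge_in_triangle[of r2 r3 r1 u v "-1"] r T only3 uv(1,2) f
          by (simp add: insert_commute eq_commute[of r2 r1] eq_commute[of r3 r1])
      next
        case False
        then obtain z where z: "z \<in> B" "z \<noteq> u" "z \<noteq> v" by blast
        have z0: "orient r1 r4 z \<noteq> 0" by (rule orient_nonzero; use z r Bd in auto)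
        \<comment> \<open>\<open>r2\<close> and \<open>r3\<close> are on opposite sides of
          \<open>r1 r4\<close>, so any point off this line shares a side with one of them.\<close>
        have side23: "orient r1 r4 y * orient r1 r4 r3 > 0 \<or> orient r1 r4 y * orient r1 r4 r2 > 0"
          if y: "orient r1 r4 y \<noteq> 0" for y
        proof (rule ccontr)
          let ?y = "orient r1 r4 y"
          assume "\<not> ?thesis"
          then have "?y * orient r1 r4 r3 < 0" "?y * orient r1 r4 r2 < 0"
            using y K0(1,2) by (metis linorder_neqE_linordered_idom mult_eq_0_iff)+
          then have "\<alpha> * (?y * orient r1 r4 r2) < 0" "\<beta> * (?y * orient r1 r4 r3) < 0"
            using r4(2,3) by (auto intro: mult_pos_neg)
          moreover have "\<alpha> * (?y * orient r1 r4 r2) + \<beta> * (?y * orient r1 r4 r3) = 0"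
            using K by algebra
          ultimately show False by linarith
        qed
        \<comment> \<open>Covers both ends of the edge through \<sigma> and both labellings of
          \<open>r2\<close> and \<open>r3\<close>; \<open>z\<close> must be on the side of the end
          \<open>v'\<close>.\<close>
        have hole: has_hole if "\<sigma> * \<sigma> = (1::real)" "u' \<in> B" "v' \<in> B"
          "\<And>x. \<sigma> * orient u' v' x = orient u v x"
          "orient r1 r4 v' * orient r1 r4 u' < 0" "z \<noteq> v'" "orient r1 r4 v' * orient r1 r4 z > 0" for \<sigma> u' v'
        proof -
          have "orient r1 r4 v' \<noteq> 0" using that by auto
          from side23[OF this] show ?thesis
          proof
            assume "orient r1 r4 v' * orient r1 r4 r3 > 0"
            then show ?thesis
              using hole_cone_split[of r1 r2 r3 r4 \<alpha> \<beta> \<sigma> u' v' z] r T only(1) r4 that uv f z by auto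
          next
            assume "orient r1 r4 v' * orient r1 r4 r2 > 0"
            moreover have "r4 = (1 + \<beta> + \<alpha>) *\<^sub>R r1 + (- \<beta>) *\<^sub>R r3 + (- \<alpha>) *\<^sub>R r2"
              using r4(1) by (simp add: algebra_simps)
            moreover have "B \<subseteq> convex hull {r1, r3, r2}" using T by (simp add: insert_commute)
            moreover have "R \<inter> convex hull {r1, r3, r2, r4} \<subseteq> {r1, r3, r2, r4}"
              using only(1) by (simp add: insert_commute)
            ultimately show ?thesis
              using hole_cone_split[of r1 r3 r2 r4 \<beta> \<alpha> \<sigma> u' v' z] r r4(2,3) that uv f z by auto
          qed
        qed
        show ?thesis
        proof (cases "orient r1 r4 v * orient r1 r4 z > 0")
          case True
          then show ?thesis using hole[of 1 u v] uv split z by auto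
        next
          case False
          then have "orient r1 r4 u * orient r1 r4 z > 0"
            using mult_pos_opposite_side[OF split _ z0] by blast
          then show ?thesis using hole[of "-1" v u] uv split z
            by (auto simp: orient_swap[of v u] mult.commute)
        qed
      qed
    qed
  qed
qed

text \<open>A red triangle around a blue point and then a fourth red point are chosen with the
  fewest red points in the hull. The signs of the barycentric coordinates of \<open>r4\<close> tell
  convex position (one negative) from a place behind a corner (two negative).\<close>

lemma hole_nested:
  assumes "B \<subseteq> convex hull R" "card R \<ge> 4" "card B \<ge> 2"
  shows has_hole
proof (rule ccontr)
  assume nh: "\<not> has_hole"
  obtain b0 where b0: "b0 \<in> B" using assms(3) by (metis all_not_in_conv card.empty not_numeral_le_zero)
  let ?P = "\<lambda>(a, b, c). a \<in> R \<and> b \<in> R \<and> c \<in> R \<and> distinct [a, b, c] \<and> b0 \<in> convex hull {a, b, c}"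
  let ?m = "\<lambda>(a, b, c). card (R \<inter> convex hull {a, b, c})"
  have "\<exists>t. ?P t"
  proof -
    obtain S where S: "finite S" "S \<subseteq> R" "card S \<le> 3" "b0 \<in> convex hull S"
      using assms(1) b0 caratheodory[of R] by auto
    \<comment> \<open>Caratheodory may give fewer than three points, so the set is filled
      up.\<close>
    obtain S' where S': "S \<subseteq> S'" "S' \<subseteq> R" "card S' = 3"
      using exists_subset_between[of S 3 R] S assms(2) finite_R by auto
    then obtain a b c where "S' = {a, b, c}" "distinct [a, b, c]" by (auto simp: card_3_iff)
    moreover have "b0 \<in> convex hull S'" using S S' hull_mono by blast
    ultimately have "?P (a, b, c)" using S' by simp
    then show ?thesis by blast
  qed
  then obtain t where t: "?P t" "\<And>t'. ?P t' \<Longrightarrow> ?m t \<le> ?m t'"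
    using ex_has_least_nat[of ?P _ ?m] by blast
  obtain r1 r2 r3 where t_eq: "t = (r1, r2, r3)" by (cases t) auto
  have r: "r1 \<in> R" "r2 \<in> R" "r3 \<in> R" "distinct [r1, r2, r3]" "b0 \<in> convex hull {r1, r2, r3}"
    using t(1) t_eq by auto
  have min: "card (R \<inter> convex hull {r1, r2, r3}) \<le> card (R \<inter> convex hull {a, b, c})"
    if "a \<in> R" "b \<in> R" "c \<in> R" "distinct [a, b, c]" "b0 \<in> convex hull {a, b, c}" for a b c
    using t(2)[of "(a, b, c)"] that t_eq by simp
  have vert: "a \<notin> convex hull {b, c}" if "a \<in> R" "b \<in> R" "c \<in> R" "distinct [a, b, c]" for a b c
  proof
    assume "a \<in> convex hull {b, c}"
    then have "orient b c a = 0" using orient_collinear by (simp add: segment_convex_hull)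
    then show False using orient_nonzero[of b c a] that by auto
  qed
  have only3: "R \<inter> convex hull {r1, r2, r3} \<subseteq> {r1, r2, r3}"
  proof (rule ccontr)
    assume "\<not> ?thesis"
    then obtain x where x: "x \<in> R" "x \<in> convex hull {r1, r2, r3}" "x \<notin> {r1, r2, r3}" by blast
    \<comment> \<open>Some corner can be exchanged for \<open>x\<close> with \<open>b0\<close> still
      inside, against minimality.\<close>
    obtain b where b: "b \<in> {r1, r2, r3}" "b0 \<in> convex hull (insert x ({r1, r2, r3} - {b}))"
      using in_convex_hull_exchange[OF x(2) r(5)] by blast
    obtain y y' where y: "{r1, r2, r3} - {b} = {y, y'}" "y \<in> R" "y' \<in> R" "distinct [b, y, y']"
      "y \<noteq> x" "y' \<noteq> x" "b \<in> R"
    proof -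
      have "b = r1 \<or> b = r2 \<or> b = r3" using b(1) by simp
      then show thesis
      proof (elim disjE)
        assume "b = r1" then show thesis using r(1-4) x(3) by (intro that[of r2 r3]) auto
      next
        assume "b = r2" then show thesis using r(1-4) x(3) by (intro that[of r1 r3]) auto
      next
        assume "b = r3" then show thesis using r(1-4) x(3) by (intro that[of r1 r2]) auto
      qed
    qed
    have "b \<notin> convex hull ({r1, r2, r3} - {b})" unfolding y(1) by (rule vert) (use y(2-7) in auto)
    moreover have "card (R \<inter> convex hull {r1, r2, r3}) \<le> card (R \<inter> convex hull (insert x ({r1, r2, r3} - {b})))"
      using b(2) unfolding y(1) by (rule min[rotated -1]) (use y(2-7) x(1) in auto)
    moreover have "card (R \<inter> convex hull (insert x ({r1, r2, r3} - {b}))) < card (R \<inter> convex hull {r1, r2, r3})"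
      by (rule card_hull_exchange_less[of _ _ b x]) (use finite_R b(1) y(7) x(2,3) calculation(1) in auto)
    ultimately show False by linarith
  qed
  have BT: "B \<subseteq> convex hull {r1, r2, r3}" using blue_in_triangle[OF nh] r b0 by blast
  let ?n = "\<lambda>x. card (R \<inter> convex hull {r1, r2, r3, x})"
  have "R - {r1, r2, r3} \<noteq> {}"
  proof
    assume "R - {r1, r2, r3} = {}"
    then have "card R \<le> card {r1, r2, r3}" by (intro card_mono) auto
    also have "\<dots> \<le> 3" by (simp add: card_insert_le_m1)
    finally show False using assms(2) by simp
  qed
  then obtain r4 where r4: "r4 \<in> R - {r1, r2, r3}" "\<And>x. x \<in> R - {r1, r2, r3} \<Longrightarrow> ?n r4 \<le> ?n x"
    using ex_has_least_nat[of "\<lambda>x. x \<in> R - {r1, r2, r3}" _ ?n] by blast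
  have out: "r4 \<notin> convex hull {r1, r2, r3}" using only3 r4(1) by blast
  have d4: "distinct [r1, r2, r3, r4]" using r(4) r4(1) by auto
  have only4: "R \<inter> convex hull {r1, r2, r3, r4} \<subseteq> {r1, r2, r3, r4}"
  proof
    fix x assume x: "x \<in> R \<inter> convex hull {r1, r2, r3, r4}"
    show "x \<in> {r1, r2, r3, r4}"
    proof (rule ccontr)
      assume n: "x \<notin> {r1, r2, r3, r4}"
      have "{r1, r2, r3, r4} - {r4} = {r1, r2, r3}" using d4 by auto
      then have "?n x < ?n r4"
        by (intro card_hull_exchange_less[of _ _ r4 x]) (use finite_R r4 out x n in auto)
      then show False using r4(2)[of x] x n by auto
    qed
  qed
  have D: "orient r1 r2 r3 \<noteq> 0" by (rule orient_nonzero) (use r in auto)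
  define l1 l2 l3 where l: "l1 = orient r2 r3 r4 / orient r1 r2 r3" "l2 = orient r3 r1 r4 / orient r1 r2 r3"
    "l3 = orient r1 r2 r4 / orient r1 r2 r3"
  have r4c: "r4 = l1 *\<^sub>R r1 + l2 *\<^sub>R r2 + l3 *\<^sub>R r3" "l1 + l2 + l3 = 1"
    using orient_barycentric[OF D, of r4] l by auto
  have "orient r2 r3 r4 \<noteq> 0" "orient r3 r1 r4 \<noteq> 0" "orient r1 r2 r4 \<noteq> 0"
    by (rule orient_nonzero; use r r4(1) in auto)+
  then have l0: "l1 \<noteq> 0" "l2 \<noteq> 0" "l3 \<noteq> 0" using l D by auto
  have quad: False
    if a: "a \<in> R" "b \<in> R" "c \<in> R" "distinct [a, b, c, r4]" "{a, b, c} = {r1, r2, r3}"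
      and k: "r4 = k1 *\<^sub>R a + k2 *\<^sub>R b + k3 *\<^sub>R c" "k1 + k2 + k3 = 1" "k1 > 0" "k2 > 0" "k3 < 0"
    for a b c k1 k2 k3
  proof -
    have h: "convex hull {a, b, c} = convex hull {r1, r2, r3}" "{a, b, c, r4} = {r1, r2, r3, r4}"
      "{b, a, c} = {r1, r2, r3}" "{b, a, c, r4} = {r1, r2, r3, r4}"
      using a(5) by auto
    \<comment> \<open>The diagonal \<open>c r4\<close> splits the quadrilateral. Eliminating
      \<open>b\<close> shows that the sign of \<open>m1 * k2 - m2 * k1\<close> decides which part
      contains \<open>b0\<close>.\<close>
    have half: "b0 \<in> convex hull {a, c, r4}"
      if m: "b0 = m1 *\<^sub>R a + m2 *\<^sub>R b + m3 *\<^sub>R c" "m1 + m2 + m3 = 1" "0 \<le> m1" "0 \<le> m2" "0 \<le> m3"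
        and k: "r4 = k1 *\<^sub>R a + k2 *\<^sub>R b + k3 *\<^sub>R c" "k1 + k2 + k3 = 1" "k2 > 0" "k3 < 0"
        and mk: "m1 * k2 \<ge> m2 * k1" for a b m1 m2 m3 k1 k2
    proof -
      have "b = (1 / k2) *\<^sub>R (k2 *\<^sub>R b)" using k(3) by simp
      also have "k2 *\<^sub>R b = r4 - k1 *\<^sub>R a - k3 *\<^sub>R c" using k(1) by simp
      finally have "b0 = m1 *\<^sub>R a + m2 *\<^sub>R ((1 / k2) *\<^sub>R (r4 - k1 *\<^sub>R a - k3 *\<^sub>R c)) + m3 *\<^sub>R c"
        using m(1) by metis
      then have "b0 = (m1 - m2 * k1 / k2) *\<^sub>R a + (m3 - m2 * k3 / k2) *\<^sub>R c + (m2 / k2) *\<^sub>R r4"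
        by (simp add: algebra_simps)
      moreover have "m1 - m2 * k1 / k2 \<ge> 0" using mk k(3) by (simp add: pos_divide_le_eq)
      moreover have "m3 - m2 * k3 / k2 \<ge> 0"
      proof -
        have "m2 * k3 / k2 \<le> 0" using m(4) k(3,4) by (simp add: divide_nonpos_pos mult_nonneg_nonpos)
        then show ?thesis using m(5) by linarith
      qed
      moreover have "m2 / k2 \<ge> 0" using m k by simp
      moreover have "(m1 - m2 * k1 / k2) + (m3 - m2 * k3 / k2) + m2 / k2 = 1"
      proof -
        have k': "k1 = 1 - k2 - k3" using k(2) by simp
        have "(m1 - m2 * k1 / k2) + (m3 - m2 * k3 / k2) + m2 / k2 = m1 + m2 + m3"
          unfolding k' using k(3) by (simp add: field_simps)
        then show ?thesis using m(2) by simp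
      qed
      ultimately show ?thesis unfolding convex_hull_3 by blast
    qed
    obtain m1 m2 m3 where m: "b0 = m1 *\<^sub>R a + m2 *\<^sub>R b + m3 *\<^sub>R c" "m1 + m2 + m3 = 1"
      "0 \<le> m1" "0 \<le> m2" "0 \<le> m3" using r(5)[folded h(1)] unfolding convex_hull_3 by blast
    have k': "r4 = k2 *\<^sub>R b + k1 *\<^sub>R a + k3 *\<^sub>R c" "k2 + k1 + k3 = 1" using k by (auto simp: algebra_simps)
    have m': "b0 = m2 *\<^sub>R b + m1 *\<^sub>R a + m3 *\<^sub>R c" "m2 + m1 + m3 = 1" using m by (auto simp: algebra_simps)
    have r4R: "r4 \<in> R" using r4(1) by blast
    have dist: "distinct [a, c, r4]" "distinct [b, c, r4]" "distinct [b, a, c, r4]" using a(4) by auto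
    have sub: "B \<subseteq> convex hull {a, b, c}" "B \<subseteq> convex hull {b, a, c}"
      "R \<inter> convex hull {a, b, c, r4} \<subseteq> {a, b, c, r4}" "R \<inter> convex hull {b, a, c, r4} \<subseteq> {b, a, c, r4}"
      "r4 \<notin> convex hull {a, b, c}" "r4 \<notin> convex hull {b, a, c}"
      unfolding h by (rule BT only4 out)+
    have has_hole
    proof (cases "m1 * k2 \<ge> m2 * k1")
      case True
      then have "b0 \<in> convex hull {a, c, r4}" by (rule half[OF m k(1,2,4,5)])
      then have "B \<subseteq> convex hull {a, c, r4}"
        using blue_in_triangle[OF nh a(1,3) r4R dist(1) b0] by blast
      then show ?thesis
        by (rule hole_quadrilateral[OF a(1,2,3) r4R a(4) sub(1) _ sub(3,5) k assms(3)])
    next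
      case False
      then have "m2 * k1 \<ge> m1 * k2" by simp
      then have "b0 \<in> convex hull {b, c, r4}" by (rule half[OF m'(1,2) m(4,3,5) k'(1,2) k(3,5)])
      then have "B \<subseteq> convex hull {b, c, r4}"
        using blue_in_triangle[OF nh a(2,3) r4R dist(2) b0] by blast
      then show ?thesis
        by (rule hole_quadrilateral[OF a(2,1,3) r4R dist(3) sub(2) _ sub(4,6) k' k(4,3,5) assms(3)])
    qed
    then show False using nh by simp
  qed
  have cone: False
    if a: "a \<in> R" "b \<in> R" "c \<in> R" "distinct [a, b, c, r4]" "{a, b, c} = {r1, r2, r3}"
      and k: "r4 = k1 *\<^sub>R a + k2 *\<^sub>R b + k3 *\<^sub>R c" "k1 + k2 + k3 = 1" "k2 < 0" "k3 < 0"
    for a b c k1 k2 k3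
  proof -
    have h: "{a, b, c, r4} = {r1, r2, r3, r4}" using a(5) by auto
    have r4R: "r4 \<in> R" using r4(1) by blast
    have sub: "B \<subseteq> convex hull {a, b, c}" "R \<inter> convex hull {a, b, c, r4} \<subseteq> {a, b, c, r4}"
      "r4 \<notin> convex hull {a, b, c}"
      unfolding h a(5) by (rule BT only4 out)+
    have "k1 = 1 + (-k2) + (-k3)" using k(2) by simp
    then have "r4 = (1 + (-k2) + (-k3)) *\<^sub>R a + (- (-k2)) *\<^sub>R b + (- (-k3)) *\<^sub>R c" using k(1) by simp
    then have has_hole
      by (rule hole_cone[OF a(1,2,3) r4R a(4) sub(1-3) _ _ _ assms(3)]) (use k(3,4) in auto)
    then show False using nh by simp
  qed
  have notpos: "\<not> (l1 > 0 \<and> l2 > 0 \<and> l3 > 0)"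
    using out r4c unfolding convex_hull_3 by fastforce
  have perm: "r4 = l2 *\<^sub>R r2 + l3 *\<^sub>R r3 + l1 *\<^sub>R r1" "l2 + l3 + l1 = 1"
    "r4 = l3 *\<^sub>R r3 + l1 *\<^sub>R r1 + l2 *\<^sub>R r2" "l3 + l1 + l2 = 1"
    using r4c by (auto simp: algebra_simps)
  have sets: "{r2, r3, r1} = {r1, r2, r3}" "{r3, r1, r2} = {r1, r2, r3}" by auto
  have dist: "distinct [r2, r3, r1, r4]" "distinct [r3, r1, r2, r4]" using d4 by auto
  note cases = quad[OF r(1,2,3) d4 refl r4c] quad[OF r(2,3,1) dist(1) sets(1) perm(1,2)]
    quad[OF r(3,1,2) dist(2) sets(2) perm(3,4)]
    cone[OF r(1,2,3) d4 refl r4c] cone[OF r(2,3,1) dist(1) sets(1) perm(1,2)]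
    cone[OF r(3,1,2) dist(2) sets(2) perm(3,4)]
  \<comment> \<open>Up to rotation of the labels, one coordinate is negative or at least two
    are.\<close>
  consider "l1 > 0" "l2 > 0" "l3 < 0" | "l2 > 0" "l3 > 0" "l1 < 0" | "l3 > 0" "l1 > 0" "l2 < 0"
    | "l2 < 0" "l3 < 0" | "l3 < 0" "l1 < 0" | "l1 < 0" "l2 < 0"
    using notpos l0 unfolding linorder_neq_iff by blast
  then show False
  proof cases
    case 1 then show False by (rule cases(1))
  next
    case 2 then show False by (rule cases(2))
  next
    case 3 then show False by (rule cases(3))
  next
    case 4 then show False by (rule cases(4))
  next
    case 5 then show False by (rule cases(5))
  next
    case 6 then show False by (rule cases(6))
  qed
qed

end

section \<open>Boundaries of convex hulls\<close>

text \<open>By Caratheodory at most three points span \<open>y\<close>. Three positive weights would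
  make it interior, so one weight vanishes. The segment need not be an edge: a chord is enough for a
  crossing.\<close>

lemma frontier_hull_segment:
  assumes "finite X" "general_position X" "y \<in> frontier (convex hull X)"
  obtains a b where "a \<in> X" "b \<in> X" "y \<in> closed_segment a b"
proof -
  have "closed (convex hull X)"
    using assms(1) by (simp add: compact_imp_closed finite_imp_compact_convex_hull)
  then have y: "y \<in> convex hull X" "y \<notin> interior (convex hull X)"
    using assms(3) by (auto simp: frontier_def)
  obtain S where S: "finite S" "S \<subseteq> X" "card S \<le> 3" "y \<in> convex hull S"
    using y(1) caratheodory[of X] by auto
  have seg: thesis if "a \<in> X" "b \<in> X" "y \<in> convex hull {a, b}" for a b
    using that that(3) \<open>\<And>a b. a \<in> X \<Longrightarrow> b \<in> X \<Longrightarrow> y \<in> closed_segment a b \<Longrightarrow> thesis\<close>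
    by (simp add: segment_convex_hull)
  have "S \<noteq> {}" using S(4) by auto
  then consider "card S = 1" | "card S = 2" | "card S = 3"
    using S(1,3) by (metis One_nat_def card_gt_0_iff le_SucE le_zero_eq less_irrefl numeral_2_eq_2 numeral_3_eq_3)
  then show thesis
  proof cases
    case 1
    then obtain a where "S = {a}" by (auto simp: card_1_singleton_iff)
    then show thesis using seg[of a a] S by auto
  next
    case 2
    then obtain a b where "S = {a, b}" by (auto simp: card_2_iff)
    then show thesis using seg[of a b] S by auto
  next
    case 3
    then obtain a b c where abc: "S = {a, b, c}" "a \<noteq> b" "a \<noteq> c" "b \<noteq> c" by (auto simp: card_3_iff)
    then have X: "a \<in> X" "b \<in> X" "c \<in> X" using S(2) by auto
    define s where "s = orient a b c"
    have s: "s \<noteq> 0" using orient_neq_0[OF assms(2) X] abc s_def by simp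
    obtain l m n where k: "y = l *\<^sub>R a + m *\<^sub>R b + n *\<^sub>R c" "l + m + n = 1" "0 \<le> l" "0 \<le> m" "0 \<le> n"
      using S(4) unfolding abc(1) convex_hull_3 by blast
    note yo = orient_convex_comb[OF k(2), of _ _ a b c, folded k(1)]
    have rot: "orient b c a = s" "orient c a b = s" unfolding s_def by (metis orient_rotate)+
    consider "l = 0" | "m = 0" | "n = 0" | "l > 0" "m > 0" "n > 0" using k by linarith
    then show thesis
    proof cases
      case 1
      then show thesis using k X by (intro seg[of b c]) (auto simp: convex_hull_2)
    next
      case 2
      then show thesis using k X by (intro seg[of a c]) (auto simp: convex_hull_2)
    next
      case 3
      then show thesis using k X by (intro seg[of a b]) (auto simp: convex_hull_2)
    next
      case 4
      have ss: "s * s > 0" using s by (simp add: zero_less_mult_iff linorder_neq_iff disj_commute)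
      have "s * orient a b y = n * (s * s)" "s * orient b c y = l * (s * s)" "s * orient c a y = m * (s * s)"
        using yo[of a b] yo[of b c] yo[of c a] rot s_def by auto
      then have "s * orient a b y > 0" "s * orient b c y > 0" "s * orient c a y > 0"
        using mult_pos_pos[OF _ ss] 4 by metis+
      then have "y \<in> interior (convex hull {a, b, c})" by (rule in_interior_triangle)
      moreover have "interior (convex hull {a, b, c}) \<subseteq> interior (convex hull X)"
        using X by (intro interior_mono hull_mono) auto
      ultimately show thesis using y(2) by blast
    qed
  qed
qed

text \<open>A supporting line cuts out a face, spanned by the points of \<open>B\<close> on it; in
  general position these are only \<open>p\<close> and \<open>w\<close>.\<close>

lemma supporting_segment_face_of:
  assumes "finite B" "general_position B" "p \<in> B" "w \<in> B" "p \<noteq> w" "s \<noteq> 0"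
    and "\<And>x. x \<in> B \<Longrightarrow> s * orient p w x \<le> 0"
  shows "closed_segment p w face_of convex hull B"
proof -
  let ?a = "s *\<^sub>R (snd p - snd w, fst w - fst p)"
  have eq: "s * orient p w x = inner ?a x - inner ?a p" for x
    by (simp add: orient_as_inner inner_prod_def algebra_simps)
  let ?F = "convex hull B \<inter> {x. inner ?a x = inner ?a p}"
  have "inner ?a x \<le> inner ?a p" if "x \<in> convex hull B" for x
  proof -
    have "(-s) * orient p w x \<ge> 0" using that by (rule orient_nonneg_on_hull[rotated]) (use assms(7) in auto)
    then show ?thesis using eq[of x] by linarith
  qed
  then have face: "?F face_of convex hull B"
    by (intro face_of_Int_supporting_hyperplane_le convex_convex_hull) auto
  then obtain S' where S': "S' \<subseteq> B" "?F = convex hull S'"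
    using face_of_convex_hull_subset[OF finite_imp_compact[OF assms(1)]] by metis
  have "S' \<subseteq> {p, w}"
  proof
    fix x assume x: "x \<in> S'"
    then have "x \<in> ?F" unfolding S'(2) by (rule hull_inc)
    then have "orient p w x = 0" using eq[of x] assms(6) by auto
    then show "x \<in> {p, w}" using orient_neq_0[OF assms(2-4), of x] assms(5) S'(1) x by auto
  qed
  then have "?F \<subseteq> convex hull {p, w}" unfolding S'(2) by (rule hull_mono)
  moreover have "{p, w} \<subseteq> ?F" using assms(3,4) eq[of w] by (simp add: hull_inc)
  then have "convex hull {p, w} \<subseteq> ?F" using face_of_imp_convex[OF face] by (rule hull_minimal)
  ultimately have "?F = closed_segment p w" unfolding segment_convex_hull by (rule subset_antisym)
  then show ?thesis using face by simp
qed

lemma connected_frontier_compact_convex: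
  fixes A :: "point set"
  assumes "convex A" "compact A"
  shows "connected (frontier A)"
proof (cases "interior A = {}")
  case True
  then have "frontier A = A" using assms(2) by (simp add: frontier_def compact_imp_closed)
  then show ?thesis using assms(1) convex_connected by simp
next
  case False
  \<comment> \<open>A nonempty interior forces dimension two and excludes the two-point relative
    boundary of a segment.\<close>
  then have "aff_dim A \<noteq> 1" using aff_dim_nonempty_interior[OF False] by simp
  then show ?thesis
    using connected_sphere_gen[of A] assms compact_imp_bounded rel_frontier_nonempty_interior[OF False] by metis
qed

text \<open>A connected set that meets another one but not its frontier lies inside it. This applies
  to \<open>C\<close>, or else to the frontier of \<open>A\<close>, whose hull is \<open>A\<close>
  by Krein-Milman.\<close>

lemma nested_or_frontiers_meet:
  fixes A C :: "point set"
  assumes "convex A" "compact A" "convex C" "compact C" "A \<inter> C \<noteq> {}"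
    and "frontier A \<inter> frontier C = {}"
  shows "A \<subseteq> C \<or> C \<subseteq> A"
proof (cases "frontier A \<inter> C = {}")
  case True
  then show ?thesis
    using connected_Int_frontier[OF convex_connected[OF assms(3)], of A] assms(5) by blast
next
  case False
  then have "frontier A \<subseteq> C"
    using connected_Int_frontier[OF connected_frontier_compact_convex[OF assms(1,2)] False] assms(6) by blast
  then have "convex hull (frontier A) \<subseteq> C" using assms(3) by (rule hull_minimal)
  then show ?thesis using Krein_Milman_frontier[OF assms(1,2)] by simp
qed

section \<open>Meeting boundaries of the two hulls\<close>

context bicoloured
begin

lemma red_notin_blue_segment:
  assumes "r \<in> R" "b \<in> B" "b' \<in> B"
  shows "r \<notin> closed_segment b b'"
proof
  assume s: "r \<in> closed_segment b b'"
  have "r \<noteq> b" "r \<noteq> b'" using assms disjoint by auto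
  then have "b \<noteq> b'" using s by auto
  then show False using orient_collinear[OF s] orient_nonzero[of b b' r] assms \<open>r \<noteq> b\<close> \<open>r \<noteq> b'\<close> by auto
qed

text \<open>General position keeps \<open>y\<close> off the four end points. It lies on one line and
  strictly between the ends of the other segment, so the determinant changes sign there.\<close>

lemma segments_meet_crossing:
  assumes "r \<in> R" "r' \<in> R" "b \<in> B" "b' \<in> B" "y \<in> closed_segment r r'" "y \<in> closed_segment b b'"
  shows "crossing r r' b b'"
proof -
  have opp: "orient p p' q * orient p p' q' < 0"
    if pq: "y \<in> closed_segment p p'" "y \<in> closed_segment q q'" "y \<noteq> q" "y \<noteq> q'"
      "orient p p' q \<noteq> 0" for p p' q q'
  proof -
    obtain u where u: "y = (1 - u) *\<^sub>R q + u *\<^sub>R q'" "0 \<le> u" "u \<le> 1"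
      using pq(2) by (auto simp: closed_segment_def)
    have "u \<noteq> 0" "u \<noteq> 1" using u pq(3,4) by auto
    then have u1: "0 < u" "u < 1" using u by auto
    have "orient p p' y = (1 - u) * orient p p' q + u * orient p p' q'"
      unfolding u(1) by (simp add: orient_def algebra_simps)
    then have "(1 - u) * (orient p p' q * orient p p' q) + u * (orient p p' q * orient p p' q') = 0"
      using orient_collinear[OF pq(1)] by algebra
    moreover have "(1 - u) * (orient p p' q * orient p p' q) > 0"
      using u1 pq(5) by (simp add: zero_less_mult_iff linorder_neq_iff disj_commute)
    ultimately have "u * (orient p p' q * orient p p' q') < 0" by linarith
    then show ?thesis using u1 by (simp add: mult_less_0_iff)
  qed
  have y: "y \<noteq> r" "y \<noteq> r'" "y \<noteq> b" "y \<noteq> b'"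
    using red_notin_blue_segment[of _ b b'] bicoloured.red_notin_blue_segment[OF bicoloured_swap, of _ r r'] assms by blast+
  then have ne: "r \<noteq> r'" "b \<noteq> b'" using assms by auto
  have d: "r \<noteq> b" "r \<noteq> b'" "r' \<noteq> b" using assms disjoint by auto
  have "orient r r' b \<noteq> 0" "orient b b' r \<noteq> 0" by (rule orient_nonzero; use assms ne d in auto)+
  then show ?thesis unfolding crossing_def using opp[of r r' b b'] opp[of b b' r r'] ne y assms(5,6) by simp
qed

lemma hole_frontiers_meet:
  assumes "frontier (convex hull B) \<inter> frontier (convex hull R) \<noteq> {}"
  shows has_hole
proof -
  obtain y where y: "y \<in> frontier (convex hull B)" "y \<in> frontier (convex hull R)" using assms by blast
  have "general_position R" "general_position B" using general_position_subset[OF gen_pos] by auto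
  then obtain r r' b b' where "r \<in> R" "r' \<in> R" "y \<in> closed_segment r r'"
    "b \<in> B" "b' \<in> B" "y \<in> closed_segment b b'"
    using frontier_hull_segment[OF finite_R _ y(2)] frontier_hull_segment[OF finite_B _ y(1)] by metis
  then show ?thesis using crossing_hole segments_meet_crossing by blast
qed

section \<open>Exactly three red points around the blue ones\<close>

lemma hole_edge_cond:
  assumes "B \<subseteq> convex hull R" "card R = 3" "edge_cond B R"
  shows has_hole
proof -
  obtain u v where uv: "u \<in> B" "v \<in> B" and
    c: "(card {y\<in>R. orient u v y > 0} = 2 \<and> (\<forall>x\<in>B. \<not> orient u v x > 0)) \<or>
         (card {y\<in>R. orient u v y < 0} = 2 \<and> (\<forall>x\<in>B. \<not> orient u v x < 0))"
    using assms(3) unfolding edge_cond_def by blast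
  \<comment> \<open>The sign \<open>s\<close> merges the two half-planes of
    \<open>edge_cond\<close>.\<close>
  have "\<exists>s. card {y\<in>R. s * orient u v y > 0} = 2 \<and> (\<forall>x\<in>B. s * orient u v x \<le> 0)"
    using c
  proof
    assume "card {y\<in>R. orient u v y > 0} = 2 \<and> (\<forall>x\<in>B. \<not> orient u v x > 0)"
    then show ?thesis by (intro exI[of _ 1]) (simp add: not_less)
  next
    assume "card {y\<in>R. orient u v y < 0} = 2 \<and> (\<forall>x\<in>B. \<not> orient u v x < 0)"
    then show ?thesis by (intro exI[of _ "-1"]) (simp add: not_less)
  qed
  then obtain s where s: "card {y\<in>R. s * orient u v y > 0} = 2" "\<And>x. x \<in> B \<Longrightarrow> s * orient u v x \<le> 0"
    by blast
  obtain a b where ab: "{y\<in>R. s * orient u v y > 0} = {a, b}" "a \<noteq> b" using s(1) by (auto simp: card_2_iff)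
  then have abR: "a \<in> R" "b \<in> R" "s * orient u v a > 0" "s * orient u v b > 0" by blast+
  then have "card (R - {a, b}) = 1" using assms(2) ab(2) finite_R by (simp add: card_Diff_subset)
  then obtain c where "R - {a, b} = {c}" by (auto simp: card_1_singleton_iff)
  then have R: "R = {a, b, c}" "c \<noteq> a" "c \<noteq> b" using abR by auto
  show ?thesis
    by (rule hole_beyond_edge_in_triangle[of a b c u v s]) (use R ab(2) abR uv s(2) assms(1) in auto)
qed

text \<open>\<open>p\<close> and \<open>p'\<close> are the first blue points met when the side
  \<open>r1 r2\<close> turns about \<open>r1\<close> and about \<open>r2\<close>. They differ, and
  the blue edge at \<open>p\<close> that sees \<open>r1\<close> then also sees
  \<open>r2\<close>.\<close>

lemma edge_cond_if_hole:
  assumes "B \<subseteq> convex hull R" "card R = 3" has_hole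
  shows "edge_cond B R"
proof -
  obtain Q where Q: "Q \<subseteq> R \<union> B" "card (Q \<inter> R) = 2" "card (Q \<inter> B) = 2"
    "interior (convex hull Q) \<inter> (R \<union> B) = {}"
    using assms(3) unfolding balanced_convex_4hole_def convex_4hole_def by blast
  obtain r1 r2 where r12: "Q \<inter> R = {r1, r2}" "r1 \<noteq> r2" using Q(2) by (auto simp: card_2_iff)
  obtain u v where uv: "Q \<inter> B = {u, v}" "u \<noteq> v" using Q(3) by (auto simp: card_2_iff)
  have r: "r1 \<in> R" "r2 \<in> R" "r1 \<in> Q" "r2 \<in> Q" using r12 by blast+
  have uvB: "u \<in> B" "v \<in> B" "u \<in> Q" "v \<in> Q" using uv by blast+
  have "card (R - {r1, r2}) = 1" using assms(2) r12(2) r finite_R by (simp add: card_Diff_subset)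
  then obtain r3 where "R - {r1, r2} = {r3}" by (auto simp: card_1_singleton_iff)
  then have R: "R = {r1, r2, r3}" "r3 \<noteq> r1" "r3 \<noteq> r2" using r by auto
  have RB: "r1 \<notin> B" "r2 \<notin> B" "r3 \<notin> B" using R disjoint by auto
  define s where "s = orient r1 r2 r3"
  have s: "s \<noteq> 0" unfolding s_def by (rule orient_nonzero) (use R r12 in auto)
  have base: "s * orient r1 r2 x > 0" if "x \<in> B" for x
  proof -
    have "x \<in> convex hull {r1, r2, r3}" using that assms(1) R by blast
    then have "s * orient r1 r2 x \<ge> 0" by (rule orient_nonneg_on_hull[rotated]) (auto simp: s_def)
    moreover have "orient r1 r2 x \<noteq> 0" by (rule orient_nonzero) (use that RB r r12 in auto)
    ultimately show ?thesis using s by (simp add: order_less_le)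
  qed
  have B0: "B \<noteq> {}" using uvB by auto
  have "(-s) * orient r2 r1 x > 0" if "x \<in> B" for x using base[OF that] by (simp add: orient_swap[of r2 r1])
  then obtain p where p: "p \<in> B" "\<And>x. x \<in> B \<Longrightarrow> (-s) * orient r1 p x \<le> 0"
    using angular_extreme_orient[OF finite_B B0, of "-s" r2 r1] by metis
  obtain p' where p': "p' \<in> B" "\<And>x. x \<in> B \<Longrightarrow> s * orient r2 p' x \<le> 0"
    using angular_extreme_orient[OF finite_B B0 base] by metis
  have ps: "s * orient r1 p x > 0" if "x \<in> B" "x \<noteq> p" for x
  proof -
    have "orient r1 p x \<noteq> 0" by (rule orient_nonzero) (use that RB r p(1) in auto)
    then have "s * orient r1 p x \<noteq> 0" using s by simp
    then show ?thesis using p(2)[OF that(1)] by linarith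
  qed
  have ps': "s * orient r2 p' x < 0" if "x \<in> B" "x \<noteq> p'" for x
  proof -
    have "orient r2 p' x \<noteq> 0" by (rule orient_nonzero) (use that RB r p'(1) in auto)
    then have "s * orient r2 p' x \<noteq> 0" using s by simp
    then show ?thesis using p'(2)[OF that(1)] by linarith
  qed
  \<comment> \<open>Otherwise a blue vertex \<open>x\<close> of the hole other than \<open>p\<close>
    would give a triangle \<open>r1 r2 x\<close> with \<open>p\<close> in its interior, hence in
    that of the hole.\<close>
  have pp: "p \<noteq> p'"
  proof
    assume eq: "p = p'"
    obtain x where x: "x \<in> {u, v}" "x \<noteq> p" using uv(2) by blast
    then have xB: "x \<in> B" "x \<in> Q" using uvB by auto
    have "orient r2 x p = - orient r2 p x" "orient x r1 p = orient r1 p x"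
      by (simp_all add: orient_def algebra_simps)
    then have "p \<in> interior (convex hull {r1, r2, x})"
      using base[OF p(1)] ps[OF xB(1) x(2)] ps'[OF xB(1)] x(2) eq by (intro in_interior_triangle[of s]) auto
    moreover have "interior (convex hull {r1, r2, x}) \<subseteq> interior (convex hull Q)"
      using r xB by (intro interior_mono hull_mono) auto
    ultimately show False using Q(4) p(1) by blast
  qed
  have Bp: "finite (B - {p})" "B - {p} \<noteq> {}" using finite_B pp p'(1) by auto
  have psp: "s * orient r1 p x > 0" if "x \<in> B - {p}" for x using ps that by blast
  obtain w where w: "w \<in> B - {p}" "\<And>x. x \<in> B - {p} \<Longrightarrow> s * orient p w x \<le> 0"
    using angular_extreme_orient[OF Bp psp] by metis
  have wle: "s * orient p w x \<le> 0" if "x \<in> B" for x using w(2)[of x] that by (cases "x = p") auto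
  have f1: "s * orient p w r1 > 0" using psp[OF w(1)] orient_rotate[of r1 p w] by simp
  have f2: "s * orient p w r2 > 0"
  proof -
    \<comment> \<open>The segments from \<open>r1\<close> to \<open>p\<close> and from \<open>r2\<close> to \<open>p'\<close> cross; this is the Pluecker relation at \<open>p\<close>.\<close>
    have "(s * orient p w r2) * (s * orient r1 p p')
        = - (s * orient p w r1) * (s * orient r2 p' p) - (s * orient p w p') * (s * orient r1 r2 p)"
      by (simp add: orient_def algebra_simps)
    moreover have "- (s * orient p w r1) * (s * orient r2 p' p) > 0"
      using f1 ps'[OF p(1) pp] by (intro mult_neg_neg) auto
    moreover have "(s * orient p w p') * (s * orient r1 r2 p) \<le> 0"
      using wle[OF p'(1)] base[OF p(1)] by (simp add: mult_nonpos_nonneg)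
    ultimately have "(s * orient p w r2) * (s * orient r1 p p') > 0" by linarith
    then show ?thesis using ps[OF p'(1) pp[symmetric]] by (metis less_asym zero_less_mult_iff)
  qed
  \<comment> \<open>Otherwise the red triangle, with \<open>p\<close> in it, would lie strictly
    beyond \<open>p w\<close>.\<close>
  have f3: "\<not> s * orient p w r3 > 0"
  proof
    assume f3: "s * orient p w r3 > 0"
    have "p \<in> convex hull {r1, r2, r3}" using p(1) assms(1) R by blast
    then have "s * orient p w p > 0" by (rule orient_pos_on_hull[rotated]) (use f1 f2 f3 in auto)
    then show False by simp
  qed
  have "{y\<in>R. s * orient p w y > 0} = {r1, r2}" using R f1 f2 f3 by auto
  then have c2: "card {y\<in>R. s * orient p w y > 0} = 2" using r12(2) by simp
  have face: "closed_segment p w face_of convex hull B"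
    by (rule supporting_segment_face_of[of B p w s])
      (use finite_B general_position_subset[OF gen_pos] p(1) w(1) s wle in auto)
  have two: "(card {y\<in>R. orient p w y > 0} = 2 \<and> (\<forall>x\<in>B. \<not> orient p w x > 0)) \<or>
         (card {y\<in>R. orient p w y < 0} = 2 \<and> (\<forall>x\<in>B. \<not> orient p w x < 0))"
  proof (cases "s > 0")
    case True
    then have "{y\<in>R. s * orient p w y > 0} = {y\<in>R. orient p w y > 0}"
      by (simp add: zero_less_mult_iff)
    moreover have "\<not> orient p w x > 0" if "x \<in> B" for x
      using wle[OF that] True by (simp add: mult_le_0_iff)
    ultimately show ?thesis using c2 by auto
  next
    case False
    then have sn: "s < 0" using s by simp
    then have "{y\<in>R. s * orient p w y > 0} = {y\<in>R. orient p w y < 0}"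
      by (simp add: zero_less_mult_iff)
    moreover have "\<not> orient p w x < 0" if "x \<in> B" for x
      using wle[OF that] sn by (simp add: mult_le_0_iff)
    ultimately show ?thesis using c2 by auto
  qed
  have "p \<noteq> w" "w \<in> B" using w(1) by auto
  then show ?thesis unfolding edge_cond_def
    by (intro bexI[OF _ p(1)] bexI[OF _ \<open>w \<in> B\<close>] conjI face two)
qed

lemma nested_hole_imp:
  assumes "B \<subseteq> convex hull R" has_hole
  shows "card B \<ge> 2 \<and> (card R = 3 \<and> edge_cond B R \<or> card R \<ge> 4)"
proof -
  obtain Q where Q: "card (Q \<inter> R) = 2" "card (Q \<inter> B) = 2"
    using assms(2) unfolding balanced_convex_4hole_def by blast
  have cR: "card R \<ge> 2" and cB: "card B \<ge> 2"
    using Q card_mono[OF finite_R, of "Q \<inter> R"] card_mono[OF finite_B, of "Q \<inter> B"] by auto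
  \<comment> \<open>Two red points span only a segment, which general position keeps free of blue
    points.\<close>
  have "card R \<noteq> 2"
  proof
    assume "card R = 2"
    then obtain a b where R: "R = {a, b}" by (auto simp: card_2_iff)
    obtain x where "x \<in> B" using cB by (metis all_not_in_conv card.empty not_numeral_le_zero)
    then show False using assms(1) bicoloured.red_notin_blue_segment[OF bicoloured_swap, of x a b] R
      by (auto simp: segment_convex_hull)
  qed
  then have "card R = 3 \<or> card R \<ge> 4" using cR by linarith
  then show ?thesis using edge_cond_if_hole[OF assms(1) _ assms(2)] cB by blast
qed

end

section \<open>The equivalence, from nested hulls and meeting boundaries\<close>

theorem theorem3:
  fixes R B :: "point set"
  assumes "finite R" and "finite B" and "R \<inter> B = {}"
    and "general_position (R \<union> B)"
    and "\<not> linearly_separable R B"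
  shows "(\<exists>Q. balanced_convex_4hole R B Q) \<longleftrightarrow>
    ((convex hull B \<subset> convex hull R \<and> card R = 3 \<and> card B \<ge> 2 \<and> edge_cond B R) \<or>
     (convex hull R \<subset> convex hull B \<and> card B = 3 \<and> card R \<ge> 2 \<and> edge_cond R B) \<or>
     (convex hull B \<subset> convex hull R \<and> card R \<ge> 4 \<and> card B \<ge> 2) \<or>
     (convex hull R \<subset> convex hull B \<and> card B \<ge> 4 \<and> card R \<ge> 2) \<or>
     frontier (convex hull B) \<inter> frontier (convex hull R) \<noteq> {})"
    (is "?hole \<longleftrightarrow> ?rhs")
proof -
  have RB: "bicoloured R B" using assms(1-4) by (rule bicoloured.intro)
  have BR: "bicoloured B R" using RB by (rule bicoloured.bicoloured_swap)
  have RB_sub: "B \<subseteq> convex hull R" if "convex hull B \<subseteq> convex hull R"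
    using that hull_subset[of B convex] by blast
  have BR_sub: "R \<subseteq> convex hull B" if "convex hull R \<subseteq> convex hull B"
    using that hull_subset[of R convex] by blast
  show ?thesis
  proof
    assume hole: ?hole
    then have hole': "\<exists>Q. balanced_convex_4hole B R Q" using bicoloured.has_hole_swap[OF RB] by blast
    show ?rhs
    proof (cases "frontier (convex hull B) \<inter> frontier (convex hull R) = {}")
      case disj: True
      obtain Q where "card (Q \<inter> R) = 2" "card (Q \<inter> B) = 2"
        using hole unfolding balanced_convex_4hole_def by blast
      then have ne: "R \<noteq> {}" "B \<noteq> {}" by auto
      have comp: "compact (convex hull R)" "compact (convex hull B)"
        using assms(1,2) by (auto intro: finite_imp_compact_convex_hull)
      \<comment> \<open>Disjoint compact hulls would be strictly separated by a line;
        \<open>a\<close> is nonzero because its values at a red and a blue point differ.\<close>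
      have meet: "convex hull B \<inter> convex hull R \<noteq> {}"
      proof
        assume "convex hull B \<inter> convex hull R = {}"
        then obtain a c where ac: "\<forall>x\<in>convex hull R. inner a x < c" "\<forall>x\<in>convex hull B. inner a x > c"
          using separating_hyperplane_compact_closed[of "convex hull R" "convex hull B"] comp ne
          by (auto simp: compact_imp_closed inf_commute)
        obtain r b where "r \<in> R" "b \<in> B" using ne by blast
        then have "inner a r < c" "inner a b > c" using ac by (auto simp: hull_inc)
        then have "a \<noteq> 0" by auto
        then have "linearly_separable R B"
          unfolding linearly_separable_def using ac by (intro exI[of _ a] exI[of _ c]) (auto simp: hull_inc)
        then show False using assms(5) by simp
      qed
      \<comment> \<open>A nonempty bounded hull has a nonempty frontier, so disjoint frontiers mean
        different hulls and the inclusion is proper.\<close>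
      have "frontier (convex hull R) \<noteq> {}"
        using ne comp(1) by (metis compact_imp_bounded convex_hull_eq_empty frontier_eq_empty not_bounded_UNIV)
      then have neq: "convex hull B \<noteq> convex hull R" using disj by auto
      have "convex hull B \<subseteq> convex hull R \<or> convex hull R \<subseteq> convex hull B"
        using nested_or_frontiers_meet[OF convex_convex_hull comp(2) convex_convex_hull comp(1) meet disj] .
      then show ?thesis
      proof
        assume "convex hull B \<subseteq> convex hull R"
        then show ?thesis using bicoloured.nested_hole_imp[OF RB RB_sub hole] neq by blast
      next
        assume "convex hull R \<subseteq> convex hull B"
        then show ?thesis using bicoloured.nested_hole_imp[OF BR BR_sub hole'] neq by blast
      qed
    qed blast
  next
    assume ?rhs
    then show ?hole
    proof (elim disjE conjE)
      assume "convex hull B \<subset> convex hull R" "card R = 3" "edge_cond B R"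
      then show ?thesis using bicoloured.hole_edge_cond[OF RB] RB_sub by blast
    next
      assume "convex hull R \<subset> convex hull B" "card B = 3" "edge_cond R B"
      then show ?thesis using bicoloured.hole_edge_cond[OF BR] BR_sub bicoloured.has_hole_swap[OF RB] by blast
    next
      assume "convex hull B \<subset> convex hull R" "4 \<le> card R" "2 \<le> card B"
      then show ?thesis using bicoloured.hole_nested[OF RB] RB_sub by blast
    next
      assume "convex hull R \<subset> convex hull B" "4 \<le> card B" "2 \<le> card R"
      then show ?thesis using bicoloured.hole_nested[OF BR] BR_sub bicoloured.has_hole_swap[OF RB] by blast
    next
      assume "frontier (convex hull B) \<inter> frontier (convex hull R) \<noteq> {}"
      then show ?thesis by (rule bicoloured.hole_frontiers_meet[OF RB])
    qed
  qed
qed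

end
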